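(* Let $p\in[1,\infty)$, $\ell\in\mathbb{N}$, $\alpha,\beta>-1$, $\varpi\in\mathbb{R}^\ell$ and $F\in\mathbf{U}^{\alpha,\beta}_{\varpi,p}$. Then there exists a sequence of polynomials $\{P_n\}_{n\ge0}$ such that $$\|P_n-f\|_{\mathsf{s},p}\longrightarrow0\qquad\text{for every } f\in F.$$ As a consequence, $\mathbf{U}^{\alpha,\beta}_{\varpi,p}$ can be identified with a normed subspace of $\mathbf{W}^{\alpha,\beta}_{\varpi,p}$, by identifying $F$ with the equivalence class in $\mathbf{W}^{\alpha,\beta}_{\varpi,p}$ of the (Cauchy) sequence $\{P_n\}_{n\ge0}$.
   Context: Let $1\le p<\infty$, $\ell\in\mathbb{N}=\{1,2,\dots\}$, $\alpha,\beta>-1$, $\varpi=(\omega_0,\dots,\omega_{\ell-1})\in\mathbb{R}^\ell$, and let $d\mu^{\alpha,\beta}(x)=(1-x)^\alpha(1+x)^\beta dx$ on $[-1,1]$. Put $$\|f\|_{\mathsf{s},p}=\Big(\sum_{k=0}^{\ell-1}|f^{(k)}(\omega_k)|^p+\int_{-1}^1|f^{(\ell)}(x)|^p\,d\mu^{\alpha,\beta}(x)\Big)^{1/p}.$$ Let $U^{\alpha,\beta}_{\varpi,p}$ be the linear space of functions $f:\mathbb{R}\to\mathbb{R}$ such that: (1) $f$ has a derivative of order $k$ at $\omega_k$ for $k=1,\dots,\ell-1$; (2) $f$ is $\ell-1$ times differentiable on $(-1,1)$ and $f^{(\ell-1)}$ is absolutely continuous on every compact subset of $(-1,1)$; (3)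 $f^{(\ell)}\in L^p(\mu^{\alpha,\beta})$. On it $\|\cdot\|_{\mathsf{s},p}$ is a seminorm. $\mathbf{U}^{\alpha,\beta}_{\varpi,p}$ is the normed space of equivalence classes $F$ of $U^{\alpha,\beta}_{\varpi,p}$ under $f\sim g\iff\|f-g\|_{\mathsf{s},p}=0$, with norm $\|F\|_{\mathsf{s},p}=\|f\|_{\mathsf{s},p}$ for any $f\in F$. Let $\mathbb{P}$ be the space of all polynomials (real coefficients); $\|\cdot\|_{\mathsf{s},p}$ is a norm on $\mathbb{P}$, and $\mathbf{W}^{\alpha,\beta}_{\varpi,p}$ denotes the completion of $(\mathbb{P},\|\cdot\|_{\mathsf{s},p})$, i.e. the space of Cauchy sequences of polynomials modulo $\{P_n\}\sim\{Q_n\}\iff\|P_n-Q_n\|_{\mathsf{s},p}\to0$, with norm $\lim_n\|P_n\|_{\mathsf{s},p}$. *)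

theory Defs
  imports "HOL-Analysis.Analysis" "HOL-Computational_Algebra.Polynomial"
begin

(* f has a (two-sided) derivative of order k at x: the derivative of order k - 1 exists on a
   neighbourhood of x and is differentiable at x. Since deriv is total, (deriv ^^ k) f x is the
   k-th derivative of f only where this predicate holds. *)
primrec has_nth_deriv_at :: "nat \<Rightarrow> (real \<Rightarrow> real) \<Rightarrow> real \<Rightarrow> bool" where
  "has_nth_deriv_at 0 f x \<longleftrightarrow> True"
| "has_nth_deriv_at (Suc k) f x \<longleftrightarrow>
     eventually (has_nth_deriv_at k f) (nhds x) \<and> ((deriv ^^ k) f) field_differentiable (at x)"

definition abs_continuous_on :: "real set \<Rightarrow> (real \<Rightarrow> real) \<Rightarrow> bool" where
  "abs_continuous_on S g \<longleftrightarrow>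
     (\<forall>\<epsilon>>0. \<exists>\<delta>>0. \<forall>(n::nat) a b.
        (\<forall>i<n. a i \<le> b i \<and> a i \<in> S \<and> b i \<in> S) \<and>
        disjoint_family_on (\<lambda>i. {a i<..<b i}) {..<n} \<and>
        (\<Sum>i<n. b i - a i) < \<delta>
        \<longrightarrow> (\<Sum>i<n. \<bar>g (b i) - g (a i)\<bar>) < \<epsilon>)"

definition jacobi_measure :: "real \<Rightarrow> real \<Rightarrow> real measure" where
  "jacobi_measure \<alpha> \<beta> =
     density (lebesgue_on {-1..1}) (\<lambda>x. ennreal ((1 - x) powr \<alpha> * (1 + x) powr \<beta>))"

definition in_Lp :: "real \<Rightarrow> real measure \<Rightarrow> (real \<Rightarrow> real) \<Rightarrow> bool" where
  "in_Lp p M g \<longleftrightarrow> g \<in> borel_measurable M \<and> integrable M (\<lambda>x. \<bar>g x\<bar> powr p)"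

(* The vector (w_0, ..., w_(l-1)) is a function on nat of which only the values at k < l are used. *)
definition sob_norm ::
  "real \<Rightarrow> nat \<Rightarrow> real \<Rightarrow> real \<Rightarrow> (nat \<Rightarrow> real) \<Rightarrow> (real \<Rightarrow> real) \<Rightarrow> real" where
  "sob_norm p l \<alpha> \<beta> w f =
     ((\<Sum>k<l. \<bar>(deriv ^^ k) f (w k)\<bar> powr p)
       + (LINT x|jacobi_measure \<alpha> \<beta>. \<bar>(deriv ^^ l) f x\<bar> powr p)) powr (1 / p)"

(* By absolute continuity the derivative of order l exists almost everywhere on (-1,1), so the
   arbitrary values of deriv elsewhere affect neither the last condition nor sob_norm. *)
definition sob_functions ::
  "real \<Rightarrow> nat \<Rightarrow> real \<Rightarrow> real \<Rightarrow> (nat \<Rightarrow> real) \<Rightarrow> (real \<Rightarrow> real) set" where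
  "sob_functions p l \<alpha> \<beta> w =
     {f. (\<forall>k\<in>{1..<l}. has_nth_deriv_at k f (w k)) \<and>
         (\<forall>x\<in>{-1<..<1}. has_nth_deriv_at (l - 1) f x) \<and>
         (\<forall>K. compact K \<and> K \<subseteq> {-1<..<1} \<longrightarrow> abs_continuous_on K ((deriv ^^ (l - 1)) f)) \<and>
         in_Lp p (jacobi_measure \<alpha> \<beta>) ((deriv ^^ l) f)}"

definition U_rel ::
  "real \<Rightarrow> nat \<Rightarrow> real \<Rightarrow> real \<Rightarrow> (nat \<Rightarrow> real) \<Rightarrow> ((real \<Rightarrow> real) \<times> (real \<Rightarrow> real)) set" where
  "U_rel p l \<alpha> \<beta> w =
     {(f, g). f \<in> sob_functions p l \<alpha> \<beta> w \<and> g \<in> sob_functions p l \<alpha> \<beta> w \<and>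
              sob_norm p l \<alpha> \<beta> w (\<lambda>x. f x - g x) = 0}"

definition U_space ::
  "real \<Rightarrow> nat \<Rightarrow> real \<Rightarrow> real \<Rightarrow> (nat \<Rightarrow> real) \<Rightarrow> (real \<Rightarrow> real) set set" where
  "U_space p l \<alpha> \<beta> w = sob_functions p l \<alpha> \<beta> w // U_rel p l \<alpha> \<beta> w"

(* Operations on classes act on representatives; the unions and the_elem below are
   determined because the results do not depend on the representatives. *)
definition U_add ::
  "real \<Rightarrow> nat \<Rightarrow> real \<Rightarrow> real \<Rightarrow> (nat \<Rightarrow> real) \<Rightarrow>
   (real \<Rightarrow> real) set \<Rightarrow> (real \<Rightarrow> real) set \<Rightarrow> (real \<Rightarrow> real) set" where
  "U_add p l \<alpha> \<beta> w F G = (\<Union>f\<in>F. \<Union>g\<in>G. U_rel p l \<alpha> \<beta> w `` {\<lambda>x. f x + g x})"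

definition U_scale ::
  "real \<Rightarrow> nat \<Rightarrow> real \<Rightarrow> real \<Rightarrow> (nat \<Rightarrow> real) \<Rightarrow>
   real \<Rightarrow> (real \<Rightarrow> real) set \<Rightarrow> (real \<Rightarrow> real) set" where
  "U_scale p l \<alpha> \<beta> w c F = (\<Union>f\<in>F. U_rel p l \<alpha> \<beta> w `` {\<lambda>x. c * f x})"

definition U_norm ::
  "real \<Rightarrow> nat \<Rightarrow> real \<Rightarrow> real \<Rightarrow> (nat \<Rightarrow> real) \<Rightarrow> (real \<Rightarrow> real) set \<Rightarrow> real" where
  "U_norm p l \<alpha> \<beta> w F = the_elem (sob_norm p l \<alpha> \<beta> w ` F)"

definition poly_Cauchy ::
  "real \<Rightarrow> nat \<Rightarrow> real \<Rightarrow> real \<Rightarrow> (nat \<Rightarrow> real) \<Rightarrow> (nat \<Rightarrow> real poly) set" where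
  "poly_Cauchy p l \<alpha> \<beta> w =
     {P. \<forall>e>0. \<exists>N. \<forall>m\<ge>N. \<forall>n\<ge>N. sob_norm p l \<alpha> \<beta> w (poly (P m - P n)) < e}"

definition W_rel ::
  "real \<Rightarrow> nat \<Rightarrow> real \<Rightarrow> real \<Rightarrow> (nat \<Rightarrow> real) \<Rightarrow> ((nat \<Rightarrow> real poly) \<times> (nat \<Rightarrow> real poly)) set" where
  "W_rel p l \<alpha> \<beta> w =
     {(P, Q). P \<in> poly_Cauchy p l \<alpha> \<beta> w \<and> Q \<in> poly_Cauchy p l \<alpha> \<beta> w \<and>
              (\<lambda>n. sob_norm p l \<alpha> \<beta> w (poly (P n - Q n))) \<longlonglongrightarrow> 0}"

definition W_space ::
  "real \<Rightarrow> nat \<Rightarrow> real \<Rightarrow> real \<Rightarrow> (nat \<Rightarrow> real) \<Rightarrow> (nat \<Rightarrow> real poly) set set" where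
  "W_space p l \<alpha> \<beta> w = poly_Cauchy p l \<alpha> \<beta> w // W_rel p l \<alpha> \<beta> w"

definition W_class ::
  "real \<Rightarrow> nat \<Rightarrow> real \<Rightarrow> real \<Rightarrow> (nat \<Rightarrow> real) \<Rightarrow> (nat \<Rightarrow> real poly) \<Rightarrow> (nat \<Rightarrow> real poly) set" where
  "W_class p l \<alpha> \<beta> w P = W_rel p l \<alpha> \<beta> w `` {P}"

definition W_zero ::
  "real \<Rightarrow> nat \<Rightarrow> real \<Rightarrow> real \<Rightarrow> (nat \<Rightarrow> real) \<Rightarrow> (nat \<Rightarrow> real poly) set" where
  "W_zero p l \<alpha> \<beta> w = W_class p l \<alpha> \<beta> w (\<lambda>n. 0)"

definition W_add ::
  "real \<Rightarrow> nat \<Rightarrow> real \<Rightarrow> real \<Rightarrow> (nat \<Rightarrow> real) \<Rightarrow>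
   (nat \<Rightarrow> real poly) set \<Rightarrow> (nat \<Rightarrow> real poly) set \<Rightarrow> (nat \<Rightarrow> real poly) set" where
  "W_add p l \<alpha> \<beta> w X Y = (\<Union>P\<in>X. \<Union>Q\<in>Y. W_class p l \<alpha> \<beta> w (\<lambda>n. P n + Q n))"

definition W_scale ::
  "real \<Rightarrow> nat \<Rightarrow> real \<Rightarrow> real \<Rightarrow> (nat \<Rightarrow> real) \<Rightarrow>
   real \<Rightarrow> (nat \<Rightarrow> real poly) set \<Rightarrow> (nat \<Rightarrow> real poly) set" where
  "W_scale p l \<alpha> \<beta> w c X = (\<Union>P\<in>X. W_class p l \<alpha> \<beta> w (\<lambda>n. smult c (P n)))"

definition W_norm ::
  "real \<Rightarrow> nat \<Rightarrow> real \<Rightarrow> real \<Rightarrow> (nat \<Rightarrow> real) \<Rightarrow> (nat \<Rightarrow> real poly) set \<Rightarrow> real" where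
  "W_norm p l \<alpha> \<beta> w X =
     the_elem ((\<lambda>P. lim (\<lambda>n. sob_norm p l \<alpha> \<beta> w (poly (P n)))) ` X)"

definition normed_space_on ::
  "'v set \<Rightarrow> ('v \<Rightarrow> 'v \<Rightarrow> 'v) \<Rightarrow> (real \<Rightarrow> 'v \<Rightarrow> 'v) \<Rightarrow> 'v \<Rightarrow> ('v \<Rightarrow> real) \<Rightarrow> bool" where
  "normed_space_on V pls scl z nrm \<longleftrightarrow>
     z \<in> V \<and>
     (\<forall>x\<in>V. \<forall>y\<in>V. pls x y \<in> V) \<and>
     (\<forall>c. \<forall>x\<in>V. scl c x \<in> V) \<and>
     (\<forall>x\<in>V. \<forall>y\<in>V. \<forall>u\<in>V. pls (pls x y) u = pls x (pls y u)) \<and>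
     (\<forall>x\<in>V. \<forall>y\<in>V. pls x y = pls y x) \<and>
     (\<forall>x\<in>V. pls z x = x) \<and>
     (\<forall>x\<in>V. \<exists>y\<in>V. pls x y = z) \<and>
     (\<forall>c. \<forall>x\<in>V. \<forall>y\<in>V. scl c (pls x y) = pls (scl c x) (scl c y)) \<and>
     (\<forall>c d. \<forall>x\<in>V. scl (c + d) x = pls (scl c x) (scl d x)) \<and>
     (\<forall>c d. \<forall>x\<in>V. scl c (scl d x) = scl (c * d) x) \<and>
     (\<forall>x\<in>V. scl 1 x = x) \<and>
     (\<forall>x\<in>V. nrm x \<ge> 0) \<and>
     (\<forall>x\<in>V. nrm x = 0 \<longleftrightarrow> x = z) \<and>
     (\<forall>c. \<forall>x\<in>V. nrm (scl c x) = \<bar>c\<bar> * nrm x) \<and>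
     (\<forall>x\<in>V. \<forall>y\<in>V. nrm (pls x y) \<le> nrm x + nrm y)"

definition normed_subspace_of_W ::
  "real \<Rightarrow> nat \<Rightarrow> real \<Rightarrow> real \<Rightarrow> (nat \<Rightarrow> real) \<Rightarrow> (nat \<Rightarrow> real poly) set set \<Rightarrow> bool" where
  "normed_subspace_of_W p l \<alpha> \<beta> w S \<longleftrightarrow>
     S \<subseteq> W_space p l \<alpha> \<beta> w \<and>
     normed_space_on S (W_add p l \<alpha> \<beta> w) (W_scale p l \<alpha> \<beta> w) (W_zero p l \<alpha> \<beta> w) (W_norm p l \<alpha> \<beta> w)"

definition approximates ::
  "real \<Rightarrow> nat \<Rightarrow> real \<Rightarrow> real \<Rightarrow> (nat \<Rightarrow> real) \<Rightarrow> (nat \<Rightarrow> real poly) \<Rightarrow> (real \<Rightarrow> real) set \<Rightarrow> bool" where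
  "approximates p l \<alpha> \<beta> w P F \<longleftrightarrow>
     (\<forall>f\<in>F. (\<lambda>n. sob_norm p l \<alpha> \<beta> w (\<lambda>x. poly (P n) x - f x)) \<longlonglongrightarrow> 0)"

end

theory Submission
  imports Defs
begin

text \<open>
  The heart of the matter is that the derivative of order \<open>l\<close> can be treated as an arbitrary element of
  the weighted \<open>L^p\<close> space. Polynomials are dense in that space (\<open>polynomials_dense_Lp_jacobi\<close>),
  because the Jacobi weight has finite mass, measurable functions are almost everywhere limits of
  continuous ones, and the Weierstrass theorem applies on the compact interval. If \<open>Q\<close> is close to
  \<open>(deriv ^^ l) f\<close>, its \<open>l\<close>-fold primitive with the constants of integration chosen to match \<open>f\<close> and its
  derivatives at the nodes (\<open>poly_prescribed_derivatives\<close>) differs from \<open>f\<close>, in the Sobolev seminorm,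
  by the weighted distance of \<open>Q\<close> and \<open>(deriv ^^ l) f\<close> alone (\<open>polynomials_dense_sobolev\<close>).

  This computation, and already the fact that the functions form a linear space on which the Sobolev
  expression is a seminorm, uses that the derivative of order \<open>l\<close> is linear almost everywhere. Since
  that derivative is the total operator \<open>deriv\<close> applied to an absolutely continuous function,
  this requires Lebesgue's theorem that such functions are differentiable almost everywhere
  (\<open>abs_continuous_differentiable_ae\<close>). It is obtained here directly from absolute continuity and the
  Vitali covering theorem, without a detour through monotone functions: where lower and upper derivatives
  differ, disjoint intervals of small slope and disjoint intervals of large slope nearly fill the same
  open set, so that the increments over a set of tiny measure would not be small.

  Once density is known, the embedding sends a class to the class of any approximating sequence. It is
  well defined, linear, isometric and injective because limits along approximating sequences of the
  seminorm, and of the distance that it induces, are the seminorm and the distance of the limits.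
\<close>

section \<open>Absolutely continuous functions\<close>

lemma abs_continuous_on_cong:
  assumes f: "abs_continuous_on K f" and eq: "\<And>x. x \<in> K \<Longrightarrow> f x = g x"
  shows "abs_continuous_on K g"
  unfolding abs_continuous_on_def
proof (intro allI impI)
  let ?A = "\<lambda>\<delta> n a b. (\<forall>i<n. a i \<le> b i \<and> a i \<in> K \<and> b i \<in> K) \<and>
        disjoint_family_on (\<lambda>i. {a i<..<b i}) {..<n::nat} \<and> (\<Sum>i<n. b i - a i) < \<delta>"
  fix \<epsilon> :: real assume "\<epsilon> > 0"
  obtain \<delta> where \<delta>: "\<delta> > 0" "\<forall>n a b. ?A \<delta> n a b \<longrightarrow> (\<Sum>i<n. \<bar>f (b i) - f (a i)\<bar>) < \<epsilon>"
    using f[unfolded abs_continuous_on_def, rule_format, OF \<open>\<epsilon> > 0\<close>] by blast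
  show "\<exists>\<delta>>0. \<forall>n a b. ?A \<delta> n a b \<longrightarrow> (\<Sum>i<n. \<bar>g (b i) - g (a i)\<bar>) < \<epsilon>"
  proof (intro exI[of _ \<delta>] conjI allI impI \<delta>(1))
    fix n a b assume A: "?A \<delta> n a b"
    have "(\<Sum>i<n. \<bar>g (b i) - g (a i)\<bar>) = (\<Sum>i<n. \<bar>f (b i) - f (a i)\<bar>)"
      using A eq by (intro sum.cong) auto
    also have "\<dots> < \<epsilon>" using \<delta>(2) A by blast
    finally show "(\<Sum>i<n. \<bar>g (b i) - g (a i)\<bar>) < \<epsilon>" .
  qed
qed

lemma abs_continuous_on_linear:
  assumes f: "abs_continuous_on S f" and g: "abs_continuous_on S g"
  shows "abs_continuous_on S (\<lambda>x. c * f x + d * g x)"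
  unfolding abs_continuous_on_def
proof (intro allI impI)
  fix \<epsilon> :: real assume "\<epsilon> > 0"
  define M where "M = \<bar>c\<bar> + \<bar>d\<bar> + 1"
  have M: "M > 0" by (simp add: M_def)
  define \<epsilon>' where "\<epsilon>' = \<epsilon> / M"
  have \<epsilon>': "\<epsilon>' > 0" "M * \<epsilon>' = \<epsilon>" using \<open>\<epsilon> > 0\<close> M by (auto simp: \<epsilon>'_def)
  let ?A = "\<lambda>\<delta> n a b. (\<forall>i<n. a i \<le> b i \<and> a i \<in> S \<and> b i \<in> S) \<and>
        disjoint_family_on (\<lambda>i. {a i<..<b i}) {..<n::nat} \<and> (\<Sum>i<n. b i - a i) < \<delta>"
  obtain \<delta>1 where 1: "\<delta>1 > 0" "\<forall>n a b. ?A \<delta>1 n a b \<longrightarrow> (\<Sum>i<n. \<bar>f (b i) - f (a i)\<bar>) < \<epsilon>'"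
    using f[unfolded abs_continuous_on_def, rule_format, OF \<epsilon>'(1)] by blast
  obtain \<delta>2 where 2: "\<delta>2 > 0" "\<forall>n a b. ?A \<delta>2 n a b \<longrightarrow> (\<Sum>i<n. \<bar>g (b i) - g (a i)\<bar>) < \<epsilon>'"
    using g[unfolded abs_continuous_on_def, rule_format, OF \<epsilon>'(1)] by blast
  show "\<exists>\<delta>>0. \<forall>n a b. ?A \<delta> n a b \<longrightarrow>
      (\<Sum>i<n. \<bar>(c * f (b i) + d * g (b i)) - (c * f (a i) + d * g (a i))\<bar>) < \<epsilon>"
  proof (intro exI[of _ "min \<delta>1 \<delta>2"] conjI allI impI)
    show "min \<delta>1 \<delta>2 > 0" using 1 2 by simp
    fix n a b assume A: "?A (min \<delta>1 \<delta>2) n a b"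
    let ?F = "\<Sum>i<n. \<bar>f (b i) - f (a i)\<bar>" and ?G = "\<Sum>i<n. \<bar>g (b i) - g (a i)\<bar>"
    have F: "?F < \<epsilon>'" using A by (intro 1(2)[rule_format]) auto
    have G: "?G < \<epsilon>'" using A by (intro 2(2)[rule_format]) auto
    have "(\<Sum>i<n. \<bar>(c * f (b i) + d * g (b i)) - (c * f (a i) + d * g (a i))\<bar>)
        \<le> (\<Sum>i<n. \<bar>c\<bar> * \<bar>f (b i) - f (a i)\<bar> + \<bar>d\<bar> * \<bar>g (b i) - g (a i)\<bar>)"
    proof (rule sum_mono)
      fix i
      have "(c * f (b i) + d * g (b i)) - (c * f (a i) + d * g (a i))
          = c * (f (b i) - f (a i)) + d * (g (b i) - g (a i))" by (simp add: algebra_simps)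
      then show "\<bar>(c * f (b i) + d * g (b i)) - (c * f (a i) + d * g (a i))\<bar>
          \<le> \<bar>c\<bar> * \<bar>f (b i) - f (a i)\<bar> + \<bar>d\<bar> * \<bar>g (b i) - g (a i)\<bar>"
        by (metis abs_mult abs_triangle_ineq)
    qed
    also have "\<dots> = \<bar>c\<bar> * ?F + \<bar>d\<bar> * ?G"
      by (simp add: sum.distrib sum_distrib_left)
    also have "\<dots> \<le> \<bar>c\<bar> * \<epsilon>' + \<bar>d\<bar> * \<epsilon>'"
      using F G by (intro add_mono mult_left_mono) auto
    also have "\<dots> < M * \<epsilon>'"
      using \<epsilon>'(1) by (simp add: M_def algebra_simps)
    finally show "(\<Sum>i<n. \<bar>(c * f (b i) + d * g (b i)) - (c * f (a i) + d * g (a i))\<bar>) < \<epsilon>"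
      using \<epsilon>'(2) by simp
  qed
qed

lemma abs_continuous_on_poly:
  assumes "bounded S"
  shows "abs_continuous_on S (poly P)"
proof -
  obtain r where r: "S \<subseteq> {-r..r}"
    using bounded_subset_cbox_symmetric[OF assms] by (metis box_real(2))
  obtain M where M: "M > 0" "\<And>x. x \<in> {-r..r} \<Longrightarrow> \<bar>poly (pderiv P) x\<bar> \<le> M"
  proof -
    have "bounded (poly (pderiv P) ` {-r..r})"
      by (intro compact_imp_bounded compact_continuous_image continuous_intros) auto
    then show ?thesis
      using that unfolding bounded_pos by auto
  qed
  have lip: "\<bar>poly P y - poly P x\<bar> \<le> M * (y - x)" if "x \<in> S" "y \<in> S" "x \<le> y" for x y
  proof -
    have "norm (poly P y - poly P x) \<le> M * norm (y - x)"
    proof (rule field_differentiable_bound[of "{-r..r}" "poly P" "poly (pderiv P)"])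
      show "(poly P has_field_derivative poly (pderiv P) z) (at z within {-r..r})" for z
        by (rule has_field_derivative_at_within[OF poly_DERIV])
    qed (use that r M in auto)
    with that show ?thesis by simp
  qed
  show ?thesis
    unfolding abs_continuous_on_def
  proof (intro allI impI)
    fix \<epsilon> :: real assume e: "\<epsilon> > 0"
    show "\<exists>\<delta>>0. \<forall>n a b. (\<forall>i<n. a i \<le> b i \<and> a i \<in> S \<and> b i \<in> S) \<and>
        disjoint_family_on (\<lambda>i. {a i<..<b i}) {..<n::nat} \<and> (\<Sum>i<n. b i - a i) < \<delta>
        \<longrightarrow> (\<Sum>i<n. \<bar>poly P (b i) - poly P (a i)\<bar>) < \<epsilon>"
    proof (intro exI[of _ "\<epsilon> / M"] conjI allI impI)
      show "\<epsilon> / M > 0" using e M by simp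
      fix n :: nat and a b assume A: "(\<forall>i<n. a i \<le> b i \<and> a i \<in> S \<and> b i \<in> S) \<and>
        disjoint_family_on (\<lambda>i. {a i<..<b i}) {..<n} \<and> (\<Sum>i<n. b i - a i) < \<epsilon> / M"
      have "(\<Sum>i<n. \<bar>poly P (b i) - poly P (a i)\<bar>) \<le> (\<Sum>i<n. M * (b i - a i))"
        using A by (intro sum_mono lip) auto
      also have "\<dots> = M * (\<Sum>i<n. b i - a i)" by (simp add: sum_distrib_left)
      also have "\<dots> < M * (\<epsilon> / M)" using A M by (intro mult_strict_left_mono) auto
      finally show "(\<Sum>i<n. \<bar>poly P (b i) - poly P (a i)\<bar>) < \<epsilon>" using M by simp
    qed
  qed
qed

lemma sum_increments_division:
  fixes h :: "real \<Rightarrow> real"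
  assumes "a \<le> b" "d division_of {a..b}"
  shows "(\<Sum>K\<in>d. h (Sup K) - h (Inf K)) = h b - h a"
proof -
  \<comment> \<open>Additive interval functions are defined on all sets, hence the value at the empty set.\<close>
  let ?f = "\<lambda>K::real set. if K = {} then 0 else h (interval_upperbound K) - h (interval_lowerbound K)"
  interpret operative_real plus 0 ?f
    rewrites "comm_monoid_set.F (+) 0 = sum"
    by standard[1] (auto simp add: sum_def)
  have "(\<Sum>K\<in>d. h (Sup K) - h (Inf K)) = sum ?f d"
    by (rule sum.cong) (use assms in \<open>auto simp: division_of_def\<close>)
  also have "\<dots> = h b - h a"
    using division[of d a b] assms by auto
  finally show ?thesis .
qed

lemma measure_sum_division:
  assumes "D division_of S"
  shows "(\<Sum>K\<in>D. measure lebesgue K) = (\<Sum>K\<in>D. Sup K - Inf K :: real)"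
proof (rule sum.cong)
  fix K assume "K \<in> D"
  then obtain u v where "K = {u..v}" "K \<noteq> {}"
    using division_ofD(3,4)[OF assms] by (metis box_real(2))
  then show "measure lebesgue K = Sup K - Inf K" by auto
qed simp

text \<open>
  The definition speaks of finite families indexed by numbers. Divisions, that is, finite sets of
  non-overlapping compact intervals, are the form in which intervals are cut and refined below.
\<close>

lemma abs_continuous_onD_division:
  fixes h :: "real \<Rightarrow> real"
  assumes "abs_continuous_on S h" "\<eta> > 0"
  obtains \<delta> where "\<delta> > 0"
    "\<And>D. D division_of \<Union>D \<Longrightarrow> \<Union>D \<subseteq> S \<Longrightarrow> (\<Sum>K\<in>D. measure lebesgue K) < \<delta> \<Longrightarrow>
       (\<Sum>K\<in>D. \<bar>h (Sup K) - h (Inf K)\<bar>) < \<eta>"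
proof -
  obtain \<delta> where \<delta>: "\<delta> > 0" and H: "\<And>n a b. (\<forall>i<n. a i \<le> b i \<and> a i \<in> S \<and> b i \<in> S) \<and>
        disjoint_family_on (\<lambda>i. {a i<..<b i}) {..<n::nat} \<and> (\<Sum>i<n. b i - a i) < \<delta>
        \<Longrightarrow> (\<Sum>i<n. \<bar>h (b i) - h (a i)\<bar>) < \<eta>"
    using assms unfolding abs_continuous_on_def by meson
  have "(\<Sum>K\<in>D. \<bar>h (Sup K) - h (Inf K)\<bar>) < \<eta>"
    if D: "D division_of \<Union>D" "\<Union>D \<subseteq> S" "(\<Sum>K\<in>D. measure lebesgue K) < \<delta>" for D
  proof -
    have "finite D" using D by blast
    then obtain k where k: "bij_betw k {..<card D} D"
      using ex_bij_betw_nat_finite by (metis atLeast0LessThan)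
    have kD: "k i \<in> D" if "i < card D" for i
      using bij_betwE[OF k] that by blast
    have ex: "\<exists>u v. u \<le> v \<and> K = {u..v}" if "K \<in> D" for K
      using D(1) that unfolding division_of_def by (metis atLeastatMost_empty_iff box_real(2))
    have 1: "Inf (k i) \<le> Sup (k i) \<and> Inf (k i) \<in> S \<and> Sup (k i) \<in> S" if "i < card D" for i
    proof -
      note ki = kD[OF that]
      obtain u v where uv: "u \<le> v" "k i = {u..v}" using ex[OF ki] by blast
      then have "u \<in> k i" "v \<in> k i" by auto
      then have "u \<in> \<Union>D" "v \<in> \<Union>D" using UnionI[OF ki] by blast+
      then have "u \<in> S" "v \<in> S" using subsetD[OF D(2)] by blast+
      with uv show ?thesis by simp
    qed
    have int: "{Inf K<..<Sup K} = interior K" if "K \<in> D" for K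
      using ex[OF that] by auto
    have 2: "disjoint_family_on (\<lambda>i. {Inf (k i)<..<Sup (k i)}) {..<card D}"
      unfolding disjoint_family_on_def
    proof (intro ballI impI)
      fix i j assume ij: "i \<in> {..<card D}" "j \<in> {..<card D}" "i \<noteq> j"
      then have "k i \<noteq> k j"
        using k by (auto simp: bij_betw_def inj_on_def)
      with ij have "interior (k i) \<inter> interior (k j) = {}"
        using division_ofD(5)[OF D(1)] kD by auto
      with ij kD int show "{Inf (k i)<..<Sup (k i)} \<inter> {Inf (k j)<..<Sup (k j)} = {}"
        by auto
    qed
    have "(\<Sum>i<card D. Sup (k i) - Inf (k i)) = (\<Sum>K\<in>D. Sup K - Inf K)"
      by (rule sum.reindex_bij_betw[OF k])
    then have 3: "(\<Sum>i<card D. Sup (k i) - Inf (k i)) < \<delta>"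
      using D measure_sum_division[OF D(1)] by simp
    have "(\<Sum>i<card D. \<bar>h (Sup (k i)) - h (Inf (k i))\<bar>) = (\<Sum>K\<in>D. \<bar>h (Sup K) - h (Inf K)\<bar>)"
      by (rule sum.reindex_bij_betw[OF k])
    with H[of "card D" "\<lambda>i. Inf (k i)" "\<lambda>i. Sup (k i)"] 1 2 3 show ?thesis
      by simp
  qed
  with \<delta> that show ?thesis by blast
qed

section \<open>Finite Vitali families\<close>

text \<open>
  The number \<open>m\<close> is the outer Lebesgue measure of \<open>E\<close>. It stands in for the measure of sets of
  points with bad difference quotients, for which measurability is not at hand.
\<close>

lemma positive_outer_measure:
  fixes E W :: "real set"
  assumes W: "open W" "bounded W" "E \<subseteq> W" and E: "\<not> negligible E"
  obtains m where "m > 0"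
    "\<And>A. A \<in> lmeasurable \<Longrightarrow> E \<subseteq> A \<Longrightarrow> m \<le> measure lebesgue A"
    "\<And>\<epsilon>. \<epsilon> > 0 \<Longrightarrow> \<exists>U. open U \<and> E \<subseteq> U \<and> U \<subseteq> W \<and> U \<in> lmeasurable \<and> measure lebesgue U < m + \<epsilon>"
proof -
  define M where "M = measure lebesgue ` {A. A \<in> lmeasurable \<and> E \<subseteq> A}"
  define m where "m = Inf M"
  have Wm: "W \<in> lmeasurable"
    using W(1,2) by (rule lmeasurable_open[rotated])
  have ne: "M \<noteq> {}" and bdd: "bdd_below M"
  proof -
    show "M \<noteq> {}" using Wm W(3) unfolding M_def by blast
    show "bdd_below M" by (rule bdd_belowI[of _ 0]) (auto simp: M_def)
  qed
  have m_le: "m \<le> measure lebesgue A" if "A \<in> lmeasurable" "E \<subseteq> A" for A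
    unfolding m_def using that by (intro cInf_lower[OF _ bdd]) (auto simp: M_def)
  have approx: "\<exists>A. A \<in> lmeasurable \<and> E \<subseteq> A \<and> measure lebesgue A < m + e" if "e > 0" for e
  proof -
    have "Inf M < m + e"
      using that by (simp add: m_def)
    then show ?thesis
      using cInf_less_iff[OF ne bdd] by (auto simp: M_def)
  qed
  have "m > 0"
  proof (rule ccontr)
    assume "\<not> m > 0"
    then have "negligible E"
      unfolding negligible_outer using approx by (metis add_le_same_cancel2 dual_order.strict_trans1 not_le_imp_less)
    with E show False by blast
  qed
  moreover have "\<exists>U. open U \<and> E \<subseteq> U \<and> U \<subseteq> W \<and> U \<in> lmeasurable \<and> measure lebesgue U < m + \<epsilon>"
    if "\<epsilon> > 0" for \<epsilon>
  proof -
    have half: "\<epsilon>/2 > 0" using that by simp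
    obtain A where A: "A \<in> lmeasurable" "E \<subseteq> A" "measure lebesgue A < m + \<epsilon>/2"
      using approx[OF half] by blast
    obtain T where T: "open T" "A \<subseteq> T" "T - A \<in> lmeasurable" "emeasure lebesgue (T - A) < ennreal (\<epsilon>/2)"
      using sets_lebesgue_outer_open[OF fmeasurableD[OF A(1)] half] .
    have "measure lebesgue (T - A) < \<epsilon>/2"
      using T that by (simp add: emeasure_eq_measure2[OF T(3)] ennreal_less_iff)
    moreover have Teq: "T = A \<union> (T - A)" using T by auto
    then have Tm: "T \<in> lmeasurable" using A T by (metis fmeasurable.Un)
    have "measure lebesgue T \<le> measure lebesgue A + measure lebesgue (T - A)"
      using Teq A T by (metis measure_Un_le fmeasurableD)
    moreover have "measure lebesgue (T \<inter> W) \<le> measure lebesgue T"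
      using Tm Wm by (intro measure_mono_fmeasurable) auto
    ultimately have "measure lebesgue (T \<inter> W) < m + \<epsilon>" using A by linarith
    moreover have "T \<inter> W \<in> lmeasurable" using Tm Wm by blast
    ultimately show ?thesis
      using T A W by (intro exI[of _ "T \<inter> W"]) auto
  qed
  ultimately show ?thesis
    using that m_le by blast
qed

text \<open>
  By the Vitali covering theorem a countable disjoint subfamily of a fine cover of \<open>E\<close> misses only a
  null set of \<open>E\<close>, so its union has at least the outer measure of \<open>E\<close>; finitely many members already
  give all but \<open>\<epsilon>\<close> of this.
\<close>

lemma Vitali_finite_intervals:
  fixes E U :: "real set" and P :: "real \<Rightarrow> real \<Rightarrow> bool"
  assumes U: "U \<in> lmeasurable"
    and fine: "\<And>x d. x \<in> E \<Longrightarrow> d > 0 \<Longrightarrow>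
                 \<exists>u v. u < v \<and> x \<in> {u..v} \<and> v - u < d \<and> {u..v} \<subseteq> U \<and> P u v"
    and m: "\<And>A. A \<in> lmeasurable \<Longrightarrow> E \<subseteq> A \<Longrightarrow> m \<le> measure lebesgue A"
    and \<epsilon>: "\<epsilon> > 0"
  obtains D where "finite D" "pairwise disjnt D" "D division_of \<Union>D"
    "\<And>K. K \<in> D \<Longrightarrow> \<exists>u v. u < v \<and> K = {u..v} \<and> {u..v} \<subseteq> U \<and> P u v"
    "m - \<epsilon> < (\<Sum>K\<in>D. measure lebesgue K)"
proof -
  define I where "I = {(u,v). u < v \<and> {u..v} \<subseteq> U \<and> P u v}"
  define c where "c = (\<lambda>(u,v). (u + v) / 2 :: real)"
  define \<rho> where "\<rho> = (\<lambda>(u,v). (v - u) / 2 :: real)"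
  have cb: "cball (c i) (\<rho> i) = {fst i..snd i}" for i
  proof -
    obtain u v where "i = (u,v)" by (cases i)
    moreover have "(u + v) / 2 - (v - u) / 2 = u" by (simp add: field_simps)
    moreover have "(u + v) / 2 + (v - u) / 2 = v" by (simp add: field_simps)
    ultimately show ?thesis
      by (simp only: c_def \<rho>_def cball_eq_atLeastAtMost prod.case fst_conv snd_conv)
  qed
  have "0 < \<rho> i" if "i \<in> I" for i
    using that by (auto simp: I_def \<rho>_def)
  moreover have "\<exists>i. i \<in> I \<and> x \<in> cball (c i) (\<rho> i) \<and> \<rho> i < d" if "x \<in> E" "0 < d" for x d
  proof -
    from fine[OF that] obtain u v where "u < v" "x \<in> {u..v}" "v - u < d" "{u..v} \<subseteq> U" "P u v"
      by blast
    then show ?thesis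
      unfolding cb by (intro exI[of _ "(u,v)"]) (auto simp: I_def \<rho>_def)
  qed
  ultimately obtain C where C: "countable C" "C \<subseteq> I"
     "pairwise (\<lambda>i j. disjnt (cball (c i) (\<rho> i)) (cball (c j) (\<rho> j))) C"
     "negligible (E - (\<Union>i \<in> C. cball (c i) (\<rho> i)))"
    using Vitali_covering_theorem_cballs[of I \<rho> E c] by blast
  define F where "F = (\<lambda>i. {fst i..snd i}) ` C"
  have cF: "countable F" using C by (simp add: F_def)
  have F_ex: "\<exists>u v. u < v \<and> K = {u..v} \<and> {u..v} \<subseteq> U \<and> P u v" if "K \<in> F" for K
    using that C(2) by (auto simp: F_def I_def)
  have disj: "pairwise disjnt F"
    unfolding F_def by (rule pairwise_imageI) (use C(3) in \<open>auto simp: pairwise_def cb\<close>)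
  have neg: "negligible (E - \<Union>F)"
    using C(4) by (simp add: F_def cb)
  have F_lm: "K \<in> lmeasurable" if "K \<in> F" for K
    using F_ex[OF that] by auto
  have UF: "\<Union>F \<in> lmeasurable"
  proof (rule fmeasurableI2[OF U])
    show "\<Union>F \<subseteq> U" using F_ex by blast
    show "\<Union>F \<in> sets lebesgue"
      using cF F_lm by (intro sets.countable_Union) (auto intro: fmeasurableD)
  qed
  have "m \<le> measure lebesgue (\<Union>F \<union> (E - \<Union>F))"
    using UF neg by (intro m fmeasurable.Un[OF UF] negligible_imp_measurable) auto
  also have "\<dots> = measure lebesgue (\<Union>F)"
    using neg UF by (intro measure_Un_null_set) (auto simp: negligible_iff_null_sets)
  finally have mF: "m \<le> measure lebesgue (\<Union>F)" .
  have bound: "measure lebesgue (\<Union>D') \<le> measure lebesgue U" if "D' \<subseteq> F" "finite D'" for D'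
  proof (rule measure_mono_fmeasurable[OF _ _ U])
    show "\<Union>D' \<subseteq> U" using F_ex that(1) by blast
    show "\<Union>D' \<in> sets lebesgue"
      using that F_lm by (intro sets.finite_Union) (auto intro: fmeasurableD)
  qed
  obtain D where D: "D \<subseteq> F" "finite D" "measure lebesgue (\<Union>F) - \<epsilon> < measure lebesgue (\<Union>D)"
    by (rule measure_countable_Union_approachable[OF cF \<epsilon> F_lm bound])
  have "measure lebesgue (\<Union>D) \<le> (\<Sum>K\<in>D. measure lebesgue K)"
    using D F_lm by (intro measure_Union_le) (auto dest: fmeasurableD)
  moreover have "D division_of \<Union>D"
  proof (rule division_ofI)
    show "interior K1 \<inter> interior K2 = {}" if "K1 \<in> D" "K2 \<in> D" "K1 \<noteq> K2" for K1 K2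
      using disj that D(1) unfolding pairwise_def disjnt_def using interior_subset by blast
    fix K assume "K \<in> D"
    then obtain u v where "u < v" "K = {u..v}" using F_ex D(1) by blast
    then show "K \<noteq> {}" "\<exists>a b. K = cbox a b" by (auto intro: exI[of _ u] exI[of _ v])
  qed (use D in auto)
  moreover have "pairwise disjnt D"
    using disj D(1) pairwise_subset by blast
  ultimately show ?thesis
    using that[of D] D F_ex mF by fastforce
qed

section \<open>Almost everywhere differentiability of absolutely continuous functions\<close>

text \<open>
  Suppose that \<open>E\<close> has outer measure \<open>m > 0\<close>. A finite disjoint family \<open>p\<close> of intervals of steep
  descent has total length close to \<open>m\<close>, and so has a second family \<open>q\<close> of intervals of steep ascent
  that lie inside those of \<open>p\<close>. The gaps left in \<open>\<Union>p\<close> by \<open>q\<close> therefore have small total length.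
  But over these gaps \<open>h\<close> changes by its total descent over \<open>p\<close> minus its total ascent over \<open>q\<close>, which
  is at most about \<open>- 2 * r * m\<close>: this contradicts absolute continuity.
\<close>

lemma negligible_opposite_slopes:
  fixes h :: "real \<Rightarrow> real"
  assumes ac: "abs_continuous_on {a..b} h" and r: "r > 0"
    and E: "E \<subseteq> {a<..<b}"
    and up: "\<And>x d. x \<in> E \<Longrightarrow> d > 0 \<Longrightarrow>
               \<exists>u v. u < v \<and> x \<in> {u..v} \<and> v - u < d \<and> h v - h u > r * (v - u)"
    and down: "\<And>x d. x \<in> E \<Longrightarrow> d > 0 \<Longrightarrow>
               \<exists>u v. u < v \<and> x \<in> {u..v} \<and> v - u < d \<and> h v - h u < - r * (v - u)"
  shows "negligible E"
proof (rule ccontr)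
  assume nE: "\<not> negligible E"
  then have "E \<noteq> {}" by auto
  then have ab: "a < b" using E by fastforce
  obtain m where m: "m > 0"
    "\<And>A. A \<in> lmeasurable \<Longrightarrow> E \<subseteq> A \<Longrightarrow> m \<le> measure lebesgue A"
    "\<And>\<epsilon>. \<epsilon> > 0 \<Longrightarrow> \<exists>U. open U \<and> E \<subseteq> U \<and> U \<subseteq> {a<..<b} \<and> U \<in> lmeasurable \<and> measure lebesgue U < m + \<epsilon>"
    by (rule positive_outer_measure[of "{a<..<b}" E]) (use E nE in auto)
  have shrink: "\<exists>u v. u < v \<and> x \<in> {u..v} \<and> v - u < d \<and> {u..v} \<subseteq> U \<and> P u v"
    if U: "open U" "x \<in> U" and d: "d > 0"
      and fine: "\<And>d. d > 0 \<Longrightarrow> \<exists>u v. u < v \<and> x \<in> {u..v} \<and> v - u < d \<and> P u v" for U x d and P :: "real \<Rightarrow> real \<Rightarrow> bool"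
  proof -
    obtain e where e: "e > 0" "ball x e \<subseteq> U" using openE[OF U] by blast
    obtain u v where uv: "u < v" "x \<in> {u..v}" "v - u < min d e" "P u v"
      using fine[of "min d e"] d e(1) by auto
    then have "{u..v} \<subseteq> ball x e" by (auto simp: dist_real_def)
    with e uv show ?thesis by (intro exI[of _ u] exI[of _ v]) auto
  qed
  obtain \<delta> where \<delta>: "\<delta> > 0" and AC: "\<And>D. D division_of \<Union>D \<Longrightarrow> \<Union>D \<subseteq> {a..b} \<Longrightarrow>
       (\<Sum>K\<in>D. measure lebesgue K) < \<delta> \<Longrightarrow> (\<Sum>K\<in>D. \<bar>h (Sup K) - h (Inf K)\<bar>) < r * m / 2"
    by (rule abs_continuous_onD_division[OF ac, of "r * m / 2"]) (use r m in auto)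
  \<comment> \<open>The gaps will have length below \<open>4 * \<epsilon>\<close>: the two families lose at most \<open>3 * \<epsilon>\<close> of \<open>m\<close>,
    and \<open>U\<close> exceeds \<open>m\<close> by at most \<open>\<epsilon>\<close>.\<close>
  define \<epsilon> where "\<epsilon> = min (\<delta>/8) (m/8)"
  have \<epsilon>: "\<epsilon> > 0" "4 * \<epsilon> < \<delta>" "8 * \<epsilon> \<le> m" using \<delta> m(1) by (auto simp: \<epsilon>_def)
  obtain U where U: "open U" "E \<subseteq> U" "U \<subseteq> {a<..<b}" "U \<in> lmeasurable" "measure lebesgue U < m + \<epsilon>"
    using m(3)[OF \<epsilon>(1)] by blast
  have fine_p: "\<exists>u v. u < v \<and> x \<in> {u..v} \<and> v - u < d \<and> {u..v} \<subseteq> U \<and> h v - h u < - r * (v - u)"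
    if "x \<in> E" "d > 0" for x d
    by (rule shrink) (use that U down in auto)
  obtain p where p: "finite p" "pairwise disjnt p" "p division_of \<Union>p"
    "\<And>K. K \<in> p \<Longrightarrow> \<exists>u v. u < v \<and> K = {u..v} \<and> {u..v} \<subseteq> U \<and> h v - h u < - r * (v - u)"
    "m - \<epsilon> < (\<Sum>K\<in>p. measure lebesgue K)"
    by (rule Vitali_finite_intervals[where E=E, OF U(4) fine_p m(2) \<epsilon>(1)]) (blast intro: that)+
  define Op where "Op = (\<Union>K\<in>p. interior K)"
  have Op: "open Op" "Op \<subseteq> U" using p(4) interior_subset by (fastforce simp: Op_def)+
  have Opm: "Op \<in> lmeasurable"
  proof (rule lmeasurable_open)
    show "bounded Op" by (rule bounded_subset[OF _ subset_trans[OF Op(2) U(3)]]) simp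
  qed (rule Op)
  have m_int: "interior K \<in> lmeasurable \<and> measure lebesgue (interior K) = measure lebesgue K" if "K \<in> p" for K
    using p(4)[OF that] by auto
  have "measure lebesgue Op = (\<Sum>K\<in>p. measure lebesgue (interior K))"
    unfolding Op_def
  proof (rule measure_UNION'[OF p(1)])
    show "pairwise (\<lambda>x y. disjnt (interior x) (interior y)) p"
      using p(2) unfolding pairwise_def disjnt_def using interior_subset by blast
  qed (use m_int in blast)
  then have mOp: "measure lebesgue Op = (\<Sum>K\<in>p. measure lebesgue K)"
    using m_int by simp
  then have p_lt: "(\<Sum>K\<in>p. measure lebesgue K) < m + \<epsilon>"
    using measure_mono_fmeasurable[OF Op(2) fmeasurableD[OF Opm] U(4)] U(5) by linarith
  \<comment> \<open>What \<open>Op\<close> misses of \<open>E\<close> lies in \<open>U - Op\<close>, which has measure below \<open>2 * \<epsilon>\<close>.\<close>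
  have E2: "m - 2 * \<epsilon> \<le> measure lebesgue A" if A: "A \<in> lmeasurable" "E \<inter> Op \<subseteq> A" for A
  proof -
    have UO: "U - Op \<in> lmeasurable" using U(4) Opm by blast
    have "m \<le> measure lebesgue (A \<union> (U - Op))"
      using A UO U(2) by (intro m(2)) auto
    also have "\<dots> \<le> measure lebesgue A + measure lebesgue (U - Op)"
      using A UO by (intro measure_Un_le) (auto intro: fmeasurableD)
    also have "measure lebesgue (U - Op) = measure lebesgue U - measure lebesgue Op"
      using U(4) Opm Op(2) by (intro measurable_measure_Diff) (auto intro: fmeasurableD)
    finally show ?thesis using mOp p(5) U(5) by linarith
  qed
  have fine_q: "\<exists>u v. u < v \<and> x \<in> {u..v} \<and> v - u < d \<and> {u..v} \<subseteq> Op \<and> h v - h u > r * (v - u)"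
    if "x \<in> E \<inter> Op" "d > 0" for x d
    by (rule shrink) (use that Op up in auto)
  obtain q where q: "finite q" "pairwise disjnt q" "q division_of \<Union>q"
    "\<And>K. K \<in> q \<Longrightarrow> \<exists>u v. u < v \<and> K = {u..v} \<and> {u..v} \<subseteq> Op \<and> h v - h u > r * (v - u)"
    "m - 2 * \<epsilon> - \<epsilon> < (\<Sum>K\<in>q. measure lebesgue K)"
    by (rule Vitali_finite_intervals[where E="E \<inter> Op", OF Opm fine_q E2 \<epsilon>(1)]) (blast intro: that)+
  have pU: "\<Union>p \<subseteq> cbox a b"
  proof
    fix x assume "x \<in> \<Union>p"
    then have "x \<in> U" using p(4) by blast
    with U(3) show "x \<in> cbox a b" by auto
  qed
  \<comment> \<open>The gaps \<open>G\<close> arise by completing \<open>p\<close> to a division \<open>R\<close> of the whole interval, exchanging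
    \<open>p\<close> for \<open>q\<close> in it and completing the result again to a division \<open>S\<close>.\<close>
  obtain R where R: "p \<subseteq> R" "R division_of cbox a b"
    by (rule partial_division_extend_interval[OF p(3) pU])
  have Rd: "(R - p) division_of \<Union>(R - p)"
    using R(2) by (metis Diff_subset division_of_subset division_of_union_self)
  have Op_disj: "Op \<inter> interior (\<Union>(R - p)) = {}"
  proof (rule Int_interior_Union_intervals)
    show "finite (R - p)" using R(2) by blast
    show "open Op" by (rule Op)
    show "\<exists>a b. T = cbox a b" if "T \<in> R - p" for T using R(2) that by blast
    show "Op \<inter> interior T = {}" if "T \<in> R - p" for T
      unfolding Op_def using division_ofD(5)[OF R(2)] that R(1) by blast
  qed
  have qOp: "\<Union>q \<subseteq> Op" using q(4) by blast
  have t: "(q \<union> (R - p)) division_of (\<Union>q \<union> \<Union>(R - p))"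
    by (rule division_disjoint_union[OF q(3) Rd]) (use Op_disj qOp interior_subset in blast)
  have q_disj: "q \<inter> (R - p) = {}"
  proof (rule ccontr)
    assume "q \<inter> (R - p) \<noteq> {}"
    then obtain K where K: "K \<in> q" "K \<in> R - p" by blast
    then obtain u v where "u < v" "K = {u..v}" using q(4) by blast
    then have "interior K \<noteq> {}" by simp
    moreover have "interior K \<subseteq> interior (\<Union>(R - p))" using K by (intro interior_mono) blast
    moreover have "interior K \<subseteq> Op" using K qOp interior_subset by blast
    ultimately show False using Op_disj by blast
  qed
  have "\<Union>(q \<union> (R - p)) \<subseteq> cbox a b"
  proof
    fix x assume "x \<in> \<Union>(q \<union> (R - p))"
    then have "x \<in> Op \<or> x \<in> \<Union>R" using qOp by blast
    then show "x \<in> cbox a b"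
      using division_ofD(6)[OF R(2)] Op(2) U(3) by auto
  qed
  moreover have "(q \<union> (R - p)) division_of \<Union>(q \<union> (R - p))"
    using t by simp
  ultimately obtain S where S: "q \<union> (R - p) \<subseteq> S" "S division_of cbox a b"
    using partial_division_extend_interval by metis
  define G where "G = S - (q \<union> (R - p))"
  have G: "G division_of \<Union>G"
    unfolding G_def using S(2) by (metis Diff_subset division_of_subset division_of_union_self)
  have Gab: "\<Union>G \<subseteq> {a..b}"
    using division_ofD(6)[OF S(2)] unfolding G_def by auto
  \<comment> \<open>Any interval function with the same total over both divisions has the
    same total over \<open>G \<union> q\<close> as over \<open>p\<close>.\<close>
  have gap: "sum \<phi> G = sum \<phi> p - sum \<phi> q" if "sum \<phi> R = sum \<phi> S" for \<phi> :: "real set \<Rightarrow> real"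
  proof -
    have fin: "finite S" "finite R" using S(2) R(2) by blast+
    have "sum \<phi> S = sum \<phi> G + sum \<phi> (q \<union> (R - p))"
      unfolding G_def using fin S(1) by (simp add: sum.subset_diff)
    also have "sum \<phi> (q \<union> (R - p)) = sum \<phi> q + sum \<phi> (R - p)"
      using fin q(1) q_disj by (intro sum.union_disjoint) auto
    also have "sum \<phi> (R - p) = sum \<phi> R - sum \<phi> p"
      using fin R(1) by (intro sum_diff)
    finally show ?thesis using that by simp
  qed
  have incr: "(\<Sum>K\<in>R. f (Sup K) - f (Inf K)) = (\<Sum>K\<in>S. f (Sup K) - f (Inf K))" for f :: "real \<Rightarrow> real"
    using sum_increments_division[of a b R f] sum_increments_division[of a b S f] R(2) S(2) ab by simp
  have "(\<Sum>K\<in>R. measure lebesgue K) = (\<Sum>K\<in>S. measure lebesgue K)"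
    using incr[of "\<lambda>x. x"] measure_sum_division[OF R(2)] measure_sum_division[OF S(2)] by simp
  then have "(\<Sum>K\<in>G. measure lebesgue K) = (\<Sum>K\<in>p. measure lebesgue K) - (\<Sum>K\<in>q. measure lebesgue K)"
    by (rule gap)
  then have "(\<Sum>K\<in>G. measure lebesgue K) < \<delta>"
    using p_lt q(5) \<epsilon> by linarith
  then have "(\<Sum>K\<in>G. \<bar>h (Sup K) - h (Inf K)\<bar>) < r * m / 2"
    by (rule AC[OF G Gab])
  moreover have "- (\<Sum>K\<in>G. h (Sup K) - h (Inf K)) \<le> (\<Sum>K\<in>G. \<bar>h (Sup K) - h (Inf K)\<bar>)"
    unfolding sum_negf[symmetric] by (intro sum_mono) linarith
  moreover have "(\<Sum>K\<in>G. h (Sup K) - h (Inf K)) =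
      (\<Sum>K\<in>p. h (Sup K) - h (Inf K)) - (\<Sum>K\<in>q. h (Sup K) - h (Inf K))"
    by (rule gap[OF incr])
  moreover have "(\<Sum>K\<in>p. h (Sup K) - h (Inf K)) \<le> (\<Sum>K\<in>p. - r * measure lebesgue K)"
    using p(4) by (intro sum_mono) fastforce
  moreover have "(\<Sum>K\<in>q. r * measure lebesgue K) \<le> (\<Sum>K\<in>q. h (Sup K) - h (Inf K))"
    using q(4) by (intro sum_mono) fastforce
  ultimately have "r * ((\<Sum>K\<in>p. measure lebesgue K) + (\<Sum>K\<in>q. measure lebesgue K)) < r * m / 2"
    unfolding sum_distrib_left[symmetric] by (simp add: algebra_simps)
  then have "(\<Sum>K\<in>p. measure lebesgue K) + (\<Sum>K\<in>q. measure lebesgue K) < m / 2"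
    using r by (metis mult_less_cancel_left_pos times_divide_eq_right)
  then show False
    using p(5) q(5) \<epsilon> by linarith
qed

text \<open>
  Locally, in a window of length less than the \<open>\<delta>\<close> that belongs to \<open>1\<close>, disjoint intervals have
  total increment below \<open>1\<close>. If the exceptional points in the window had outer measure \<open>m > 0\<close>,
  intervals whose slope exceeds \<open>2 / m\<close> in absolute value and whose total length exceeds \<open>m / 2\<close> would violate this bound.
\<close>

lemma negligible_unbounded_slopes:
  fixes g :: "real \<Rightarrow> real"
  assumes ac: "abs_continuous_on {a..b} g"
    and E: "E \<subseteq> {a<..<b}"
    and unb: "\<And>x d n. x \<in> E \<Longrightarrow> d > 0 \<Longrightarrow>
               \<exists>u v. u < v \<and> x \<in> {u..v} \<and> v - u < d \<and> \<bar>g v - g u\<bar> > n * (v - u)"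
  shows "negligible E"
  unfolding locally_negligible_alt[of E]
proof
  fix z assume z: "z \<in> E"
  obtain \<delta> where \<delta>: "\<delta> > 0" and AC: "\<And>D. D division_of \<Union>D \<Longrightarrow> \<Union>D \<subseteq> {a..b} \<Longrightarrow>
       (\<Sum>K\<in>D. measure lebesgue K) < \<delta> \<Longrightarrow> (\<Sum>K\<in>D. \<bar>g (Sup K) - g (Inf K)\<bar>) < 1"
    by (rule abs_continuous_onD_division[OF ac, of 1]) auto
  define W where "W = {a<..<b} \<inter> {z - \<delta>/3<..<z + \<delta>/3}"
  have W: "open W" "bounded W" "W \<in> lmeasurable" "measure lebesgue W < \<delta>"
  proof -
    show 1: "open W" "bounded W" unfolding W_def by (auto intro: bounded_Int)
    then show 2: "W \<in> lmeasurable" by (rule lmeasurable_open[rotated])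
    have "measure lebesgue W \<le> measure lebesgue {z - \<delta>/3<..<z + \<delta>/3}"
      using 2 by (intro measure_mono_fmeasurable) (auto simp: W_def)
    also have "\<dots> < \<delta>" using \<delta> by simp
    finally show "measure lebesgue W < \<delta>" .
  qed
  have "negligible (E \<inter> W)"
  proof (rule ccontr)
    assume nE: "\<not> negligible (E \<inter> W)"
    obtain m where m: "m > 0"
      "\<And>A. A \<in> lmeasurable \<Longrightarrow> E \<inter> W \<subseteq> A \<Longrightarrow> m \<le> measure lebesgue A"
      by (rule positive_outer_measure[OF W(1,2) _ nE]) auto
    have m2: "m / 2 > 0" using m(1) by simp
    have fine_D: "\<exists>u v. u < v \<and> x \<in> {u..v} \<and> v - u < d \<and> {u..v} \<subseteq> W \<and> \<bar>g v - g u\<bar> > 2 / m * (v - u)"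
      if x: "x \<in> E \<inter> W" and d: "d > 0" for x d
    proof -
      obtain e where e: "e > 0" "ball x e \<subseteq> W" using openE[OF W(1)] x by blast
      obtain u v where uv: "u < v" "x \<in> {u..v}" "v - u < min d e" "\<bar>g v - g u\<bar> > 2 / m * (v - u)"
        using unb[of x "min d e" "2 / m"] x d e(1) by auto
      then have "{u..v} \<subseteq> ball x e" by (auto simp: dist_real_def)
      with e uv show ?thesis by (intro exI[of _ u] exI[of _ v]) auto
    qed
    obtain D where D: "finite D" "pairwise disjnt D" "D division_of \<Union>D"
      "\<And>K. K \<in> D \<Longrightarrow> \<exists>u v. u < v \<and> K = {u..v} \<and> {u..v} \<subseteq> W \<and> \<bar>g v - g u\<bar> > 2 / m * (v - u)"
      "m - m / 2 < (\<Sum>K\<in>D. measure lebesgue K)"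
      by (rule Vitali_finite_intervals[where E="E \<inter> W", OF W(3) fine_D m(2) m2]) (blast intro: that)+
    have mK: "K \<in> lmeasurable" if "K \<in> D" for K
      using D(4)[OF that] by auto
    have "(\<Sum>K\<in>D. measure lebesgue K) = measure lebesgue (\<Union>D)"
      using measure_Union'[OF D(1) _ D(2)] mK by simp
    also have "\<dots> \<le> measure lebesgue W"
      using D(1,4) W(3) mK by (intro measure_mono_fmeasurable) (blast intro: fmeasurableD)+
    finally have "(\<Sum>K\<in>D. measure lebesgue K) < \<delta>" using W(4) by linarith
    moreover have "\<Union>D \<subseteq> {a..b}"
    proof
      fix x assume "x \<in> \<Union>D"
      then have "x \<in> W" using D(4) by blast
      then show "x \<in> {a..b}" by (auto simp: W_def)
    qed
    ultimately have "(\<Sum>K\<in>D. \<bar>g (Sup K) - g (Inf K)\<bar>) < 1"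
      using AC[OF D(3)] by blast
    moreover have "(\<Sum>K\<in>D. 2 / m * measure lebesgue K) \<le> (\<Sum>K\<in>D. \<bar>g (Sup K) - g (Inf K)\<bar>)"
      using D(4) by (intro sum_mono) fastforce
    ultimately have "2 / m * (\<Sum>K\<in>D. measure lebesgue K) < 1"
      unfolding sum_distrib_left[symmetric] by linarith
    with D(5) m(1) show False by (simp add: field_simps)
  qed
  moreover have "openin (top_of_set E) (E \<inter> W)" using W(1) by blast
  moreover have "z \<in> W" using z E \<delta> by (auto simp: W_def)
  ultimately show "\<exists>U. openin (top_of_set E) U \<and> z \<in> U \<and> negligible U"
    using z by blast
qed

text \<open>
  Subtracting the linear function whose slope is the mean of \<open>s\<close> and \<open>t\<close> makes the two slopes
  opposite.
\<close>

lemma negligible_slope_gap: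
  fixes g :: "real \<Rightarrow> real"
  assumes ac: "abs_continuous_on {a..b} g" and st: "s < t"
    and E: "E \<subseteq> {a<..<b}"
    and up: "\<And>x. x \<in> E \<Longrightarrow> \<exists>\<^sub>F y in at x. (g y - g x) / (y - x) > t"
    and down: "\<And>x. x \<in> E \<Longrightarrow> \<exists>\<^sub>F y in at x. (g y - g x) / (y - x) < s"
  shows "negligible E"
proof -
  define c where "c = (s + t) / 2"
  define r where "r = (t - s) / 2"
  have r: "r > 0" and cr: "c + r = t" "c - r = s"
    using st by (simp_all add: c_def r_def field_simps)
  define h where "h = (\<lambda>x. g x - c * x)"
  have "abs_continuous_on {a..b} (\<lambda>x. 1 * g x + (- c) * poly [:0, 1:] x)"
    by (intro abs_continuous_on_linear ac abs_continuous_on_poly) simp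
  then have ac_h: "abs_continuous_on {a..b} h" by (simp add: h_def)
  \<comment> \<open>Quotients taken at \<open>x\<close> are slopes over intervals with \<open>x\<close> as one endpoint.\<close>
  have slope: "\<exists>u v. u < v \<and> x \<in> {u..v} \<and> v - u < d \<and> Q ((g v - g u) / (v - u))"
    if fr: "\<exists>\<^sub>F y in at x. Q ((g y - g x) / (y - x))" and d: "d > 0" for Q :: "real \<Rightarrow> bool" and x d
  proof -
    have "\<forall>\<^sub>F y in at x. y \<noteq> x \<and> dist y x < d"
      using d unfolding eventually_at by blast
    from frequently_eventually_conj[OF fr this]
    obtain y where y: "Q ((g y - g x) / (y - x))" "dist y x < d" "y \<noteq> x"
      using frequently_ex by blast
    show ?thesis
    proof (cases "x < y")
      case True
      then show ?thesis using y by (intro exI[of _ x] exI[of _ y]) (auto simp: dist_real_def)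
    next
      case False
      moreover have "(g x - g y) / (x - y) = (g y - g x) / (y - x)"
        by (metis minus_diff_eq minus_divide_divide)
      ultimately show ?thesis using y by (intro exI[of _ y] exI[of _ x]) (auto simp: dist_real_def)
    qed
  qed
  show ?thesis
  proof (rule negligible_opposite_slopes[OF ac_h r E])
    fix x d :: real assume x: "x \<in> E" and d: "d > 0"
    show "\<exists>u v. u < v \<and> x \<in> {u..v} \<and> v - u < d \<and> h v - h u > r * (v - u)"
    proof -
      obtain u v where uv: "u < v" "x \<in> {u..v}" "v - u < d" "(g v - g u) / (v - u) > t"
        using slope[OF up[OF x] d] by blast
      then have "g v - g u > (c + r) * (v - u)" unfolding cr by (simp add: field_simps)
      then have "h v - h u > r * (v - u)" by (simp add: h_def algebra_simps)
      with uv show ?thesis by blast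
    qed
    show "\<exists>u v. u < v \<and> x \<in> {u..v} \<and> v - u < d \<and> h v - h u < - r * (v - u)"
    proof -
      obtain u v where uv: "u < v" "x \<in> {u..v}" "v - u < d" "(g v - g u) / (v - u) < s"
        using slope[OF down[OF x] d] by blast
      then have "g v - g u < (c - r) * (v - u)" unfolding cr by (simp add: field_simps)
      then have "h v - h u < - r * (v - u)" by (simp add: h_def algebra_simps)
      with uv show ?thesis by blast
    qed
  qed
qed

text \<open>
  The limit is the supremum of all eventual lower bounds. Rational thresholds suffice, which later
  leaves only countably many exceptional sets.
\<close>

lemma tendsto_if_no_gap:
  fixes q :: "'a \<Rightarrow> real"
  assumes F: "F \<noteq> bot"
    and bdd: "\<forall>\<^sub>F y in F. \<bar>q y\<bar> \<le> M"
    and nogap: "\<And>s t. s \<in> \<rat> \<Longrightarrow> t \<in> \<rat> \<Longrightarrow> s < t \<Longrightarrow> (\<forall>\<^sub>F y in F. q y \<le> t) \<or> (\<forall>\<^sub>F y in F. q y \<ge> s)"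
  shows "\<exists>L. (q \<longlongrightarrow> L) F"
proof -
  define X where "X = {s. \<forall>\<^sub>F y in F. q y \<ge> s}"
  have ne: "- M \<in> X"
    unfolding X_def using bdd by (auto elim!: eventually_mono)
  have ub: "s \<le> t" if "s \<in> X" "\<forall>\<^sub>F y in F. q y \<le> t" for s t
  proof -
    have "\<forall>\<^sub>F y in F. s \<le> q y \<and> q y \<le> t"
      using that by (auto simp: X_def intro: eventually_conj)
    then obtain y where "s \<le> q y" "q y \<le> t"
      using eventually_happens'[OF F] by blast
    then show ?thesis by simp
  qed
  have "\<forall>\<^sub>F y in F. q y \<le> M" using bdd by (auto elim!: eventually_mono)
  then have bX: "bdd_above X" using ub by (intro bdd_aboveI[of _ M]) auto
  define L where "L = Sup X"
  have "(q \<longlongrightarrow> L) F"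
  proof (rule order_tendstoI)
    fix e assume "e < L"
    then obtain s where "s \<in> X" "e < s"
      using less_cSup_iff[OF _ bX] ne unfolding L_def by blast
    then show "\<forall>\<^sub>F y in F. e < q y"
      by (auto simp: X_def elim!: eventually_mono)
  next
    fix e assume "L < e"
    obtain t where t: "t \<in> \<rat>" "L < t" "t < e" using Rats_dense_in_real[OF \<open>L < e\<close>] by blast
    obtain s where s: "s \<in> \<rat>" "L < s" "s < t" using Rats_dense_in_real[OF t(2)] by blast
    have "s \<notin> X" using s(2) cSup_upper[OF _ bX, of s] by (auto simp: L_def)
    then have "\<forall>\<^sub>F y in F. q y \<le> t" using nogap[OF s(1) t(1) s(3)] by (auto simp: X_def)
    then show "\<forall>\<^sub>F y in F. q y < e" using t(3) by (auto elim!: eventually_mono)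
  qed
  then show ?thesis by blast
qed

text \<open>
  Where the difference quotients are eventually bounded and do not oscillate across any pair of
  rational levels they converge; each of the countably many exceptional sets is negligible.
\<close>

proposition abs_continuous_differentiable_ae:
  fixes g :: "real \<Rightarrow> real"
  assumes ac: "abs_continuous_on {a..b} g"
  shows "negligible {x \<in> {a<..<b}. \<not> g field_differentiable (at x)}"
proof -
  define q where "q = (\<lambda>x y. (g y - g x) / (y - x))"
  define B where "B = {x \<in> {a<..<b}. \<forall>n::real. \<exists>\<^sub>F y in at x. \<bar>q x y\<bar> > n}"
  define Osc where "Osc = (\<lambda>s t. {x \<in> {a<..<b}. (\<exists>\<^sub>F y in at x. q x y > t) \<and> (\<exists>\<^sub>F y in at x. q x y < s)})"
  have "negligible B"
  proof (rule negligible_unbounded_slopes[OF ac])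
    show "B \<subseteq> {a<..<b}" by (auto simp: B_def)
    fix x d n :: real assume x: "x \<in> B" and d: "d > 0"
    have "\<exists>\<^sub>F y in at x. \<bar>q x y\<bar> > n" using x by (auto simp: B_def)
    moreover have "\<forall>\<^sub>F y in at x. y \<noteq> x \<and> dist y x < d"
      using d unfolding eventually_at by blast
    ultimately have "\<exists>\<^sub>F y in at x. (y \<noteq> x \<and> dist y x < d) \<and> \<bar>q x y\<bar> > n"
      by (rule frequently_eventually_conj)
    then obtain y where y: "\<bar>q x y\<bar> > n" "y \<noteq> x" "dist y x < d"
      using frequently_ex by blast
    have "\<bar>g y - g x\<bar> > n * \<bar>y - x\<bar>"
      using y(1,2) by (simp add: q_def abs_divide field_simps)
    then show "\<exists>u v. u < v \<and> x \<in> {u..v} \<and> v - u < d \<and> \<bar>g v - g u\<bar> > n * (v - u)"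
      using y(2,3) by (intro exI[of _ "min x y"] exI[of _ "max x y"]) (auto simp: dist_real_def min_def max_def)
  qed
  moreover have "negligible (\<Union>s\<in>\<rat>. \<Union>t\<in>{t\<in>\<rat>. s < t}. Osc s t)"
  proof -
    have Osc_neg: "negligible (Osc s t)" if "s < t" for s t
      by (rule negligible_slope_gap[OF ac that]) (auto simp: Osc_def q_def)
    have "negligible (\<Union>t\<in>{t\<in>\<rat>. s < t}. Osc s t)" for s
    proof (rule negligible_countable_Union)
      show "countable ((\<lambda>t. Osc s t) ` {t\<in>\<rat>. s < t})"
        using countable_rat by (intro countable_image) (auto intro: countable_subset)
    qed (use Osc_neg in auto)
    then show ?thesis
      by (intro negligible_countable_Union countable_image countable_rat) auto
  qed
  moreover have "{x \<in> {a<..<b}. \<not> g field_differentiable (at x)} \<subseteq> B \<union> (\<Union>s\<in>\<rat>. \<Union>t\<in>{t\<in>\<rat>. s < t}. Osc s t)"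
  proof
    fix x assume x: "x \<in> {x \<in> {a<..<b}. \<not> g field_differentiable (at x)}"
    show "x \<in> B \<union> (\<Union>s\<in>\<rat>. \<Union>t\<in>{t\<in>\<rat>. s < t}. Osc s t)"
    proof (rule ccontr)
      assume n: "x \<notin> B \<union> (\<Union>s\<in>\<rat>. \<Union>t\<in>{t\<in>\<rat>. s < t}. Osc s t)"
      then obtain M where M: "\<forall>\<^sub>F y in at x. \<bar>q x y\<bar> \<le> M"
        using x by (auto simp: B_def frequently_def not_less)
      have "\<exists>L. (q x \<longlongrightarrow> L) (at x)"
      proof (rule tendsto_if_no_gap[OF _ M])
        fix s t :: real assume st: "s \<in> \<rat>" "t \<in> \<rat>" "s < t"
        then have "x \<notin> Osc s t" using n by blast
        then show "(\<forall>\<^sub>F y in at x. q x y \<le> t) \<or> (\<forall>\<^sub>F y in at x. q x y \<ge> s)"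
          using x by (auto simp: Osc_def frequently_def not_less)
      qed simp
      then have "g field_differentiable (at x)"
        unfolding field_differentiable_def has_field_derivative_iff q_def by blast
      with x show False by blast
    qed
  qed
  ultimately show ?thesis
    using negligible_Un negligible_subset by blast
qed

section \<open>Iterated derivatives and polynomials\<close>

text \<open>
  The function \<open>deriv\<close> is total and linear only at points of differentiability, so linearity of
  iterated derivatives needs the existence of the lower ones in a whole neighbourhood.
\<close>

lemma nth_deriv_linear:
  assumes "has_nth_deriv_at k f x" "has_nth_deriv_at k g x"
  shows "has_nth_deriv_at k (\<lambda>x. c * f x + d * g x) x \<and>
         (deriv ^^ k) (\<lambda>x. c * f x + d * g x) x = c * (deriv ^^ k) f x + d * (deriv ^^ k) g x"
  using assms
proof (induction k arbitrary: x)
  case 0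
  then show ?case by simp
next
  case (Suc k)
  let ?h = "\<lambda>x. c * f x + d * g x"
  have "\<forall>\<^sub>F y in nhds x. has_nth_deriv_at k f y \<and> has_nth_deriv_at k g y"
    using Suc.prems by (auto intro: eventually_conj)
  then have ev: "\<forall>\<^sub>F y in nhds x. has_nth_deriv_at k ?h y \<and>
      (deriv ^^ k) ?h y = c * (deriv ^^ k) f y + d * (deriv ^^ k) g y"
    by (rule eventually_mono) (use Suc.IH in blast)
  then have eq: "\<forall>\<^sub>F y in nhds x. (deriv ^^ k) ?h y = c * (deriv ^^ k) f y + d * (deriv ^^ k) g y"
    by (rule eventually_mono) blast
  have D: "((deriv ^^ k) f has_field_derivative (deriv ^^ Suc k) f x) (at x)"
          "((deriv ^^ k) g has_field_derivative (deriv ^^ Suc k) g x) (at x)"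
    using Suc.prems by (auto simp: DERIV_deriv_iff_field_differentiable)
  have "((\<lambda>y. c * (deriv ^^ k) f y + d * (deriv ^^ k) g y) has_field_derivative
          c * (deriv ^^ Suc k) f x + d * (deriv ^^ Suc k) g x) (at x)"
    by (intro DERIV_add DERIV_cmult D)
  then have DD: "((deriv ^^ k) ?h has_field_derivative
          c * (deriv ^^ Suc k) f x + d * (deriv ^^ Suc k) g x) (at x)"
    using DERIV_cong_ev[OF refl eq refl] by blast
  then have "(deriv ^^ k) ?h field_differentiable (at x)"
    by (auto simp: field_differentiable_def)
  moreover have "\<forall>\<^sub>F y in nhds x. has_nth_deriv_at k ?h y"
    using ev by (rule eventually_mono) blast
  moreover have "(deriv ^^ Suc k) ?h x = c * (deriv ^^ Suc k) f x + d * (deriv ^^ Suc k) g x"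
    using DERIV_imp_deriv[OF DD] by simp
  ultimately show ?case by simp
qed

lemma nth_deriv_poly:
  fixes P :: "real poly"
  shows "(deriv ^^ k) (poly P) = poly ((pderiv ^^ k) P)"
proof (induction k)
  case (Suc k)
  have "deriv (poly Q) = poly (pderiv Q)" for Q :: "real poly"
    by (intro ext DERIV_imp_deriv poly_DERIV)
  then show ?case by (simp add: Suc)
qed simp

lemma has_nth_deriv_at_poly:
  fixes P :: "real poly"
  shows "has_nth_deriv_at k (poly P) x"
proof (induction k arbitrary: x)
  case (Suc k)
  have "poly Q field_differentiable (at x)" for Q :: "real poly"
    using poly_DERIV field_differentiable_def by blast
  then show ?case
    using Suc by (simp add: nth_deriv_poly always_eventually)
qed simp

lemma pderiv_surj: "\<exists>P. pderiv P = (Q :: real poly)"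
proof -
  define P where "P = (\<Sum>i\<le>degree Q. monom (coeff Q i / real (Suc i)) (Suc i))"
  have "pderiv P = (\<Sum>i\<le>degree Q. monom (coeff Q i) i)"
    by (simp add: P_def higher_pderiv_sum[of 1, simplified] pderiv_monom)
  then show ?thesis
    by (metis poly_as_sum_of_monoms)
qed

text \<open>
  Integrating \<open>Q\<close> repeatedly, one constant of integration is free at each order, and it is used up by
  the value prescribed at the corresponding node.
\<close>

lemma poly_prescribed_derivatives:
  fixes Q :: "real poly" and w c :: "nat \<Rightarrow> real"
  shows "\<exists>P. (pderiv ^^ l) P = Q \<and> (\<forall>k<l. poly ((pderiv ^^ k) P) (w k) = c k)"
proof (induction l arbitrary: w c)
  case (Suc l)
  from Suc[of "\<lambda>k. w (Suc k)" "\<lambda>k. c (Suc k)"] obtain R where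
    R: "(pderiv ^^ l) R = Q" "\<And>k. k < l \<Longrightarrow> poly ((pderiv ^^ k) R) (w (Suc k)) = c (Suc k)"
    by blast
  obtain P0 where P0: "pderiv P0 = R" using pderiv_surj by blast
  define P where "P = P0 + [:c 0 - poly P0 (w 0):]"
  have P: "pderiv P = R" "poly P (w 0) = c 0"
    by (simp_all add: P_def pderiv_add P0 pderiv_pCons)
  have S: "(pderiv ^^ Suc k) P = (pderiv ^^ k) R" for k
    by (simp only: funpow_Suc_right comp_apply P)
  have "poly ((pderiv ^^ k) P) (w k) = c k" if "k < Suc l" for k
    using that R(2) S P(2) by (cases k) (simp_all del: funpow.simps(2))
  then show ?case
    using R(1) S by metis
qed simp

section \<open>Powers with exponent at least one\<close>

lemma powr_convex_nonneg:
  fixes A B s t p :: real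
  assumes p: "p \<ge> 1" and st: "s \<ge> 0" "t \<ge> 0" "s + t = 1" and AB: "A \<ge> 0" "B \<ge> 0"
  shows "(s * A + t * B) powr p \<le> s * A powr p + t * B powr p"
proof -
  have zero: "(t * B) powr p \<le> t * B powr p" if "0 \<le> t" "t \<le> 1" "0 \<le> B" for t B
  proof -
    have "t powr p \<le> t"
      using powr_mono'[of 1 p t] that p by (cases "t = 0") auto
    then show ?thesis
      using that by (simp add: powr_mult mult_right_mono)
  qed
  consider "A = 0" | "B = 0" | "A > 0" "B > 0" using AB by linarith
  then show ?thesis
  proof cases
    case 1
    then show ?thesis using zero[of t B] st AB p by simp
  next
    case 2
    then show ?thesis using zero[of s A] st AB p by simp
  next
    case 3
    have s: "s = 1 - t" using st(3) by simp
    show ?thesis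
      unfolding s using convex_onD[OF powr_convex[OF p], of t A B] st 3 by simp
  qed
qed

lemma abs_powr_convex:
  fixes a b s t p :: real
  assumes p: "p \<ge> 1" and st: "s \<ge> 0" "t \<ge> 0" "s + t = 1"
  shows "\<bar>s * a + t * b\<bar> powr p \<le> s * \<bar>a\<bar> powr p + t * \<bar>b\<bar> powr p"
proof -
  have "\<bar>s * a + t * b\<bar> \<le> s * \<bar>a\<bar> + t * \<bar>b\<bar>"
    using abs_triangle_ineq[of "s * a" "t * b"] st by (simp add: abs_mult)
  then have "\<bar>s * a + t * b\<bar> powr p \<le> (s * \<bar>a\<bar> + t * \<bar>b\<bar>) powr p"
    using p by (intro powr_mono2) auto
  also have "\<dots> \<le> s * \<bar>a\<bar> powr p + t * \<bar>b\<bar> powr p"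
    by (rule powr_convex_nonneg) (use assms in auto)
  finally show ?thesis .
qed

text \<open>
  The constant is not sharp; the bound serves to show finiteness and smallness only.
\<close>

lemma abs_powr_add_le:
  fixes a b p :: real
  assumes p: "p \<ge> 1"
  shows "\<bar>a + b\<bar> powr p \<le> 2 powr p * (\<bar>a\<bar> powr p + \<bar>b\<bar> powr p)"
proof -
  have "\<bar>a + b\<bar> powr p = 2 powr p * \<bar>1/2 * a + 1/2 * b\<bar> powr p"
  proof -
    have half: "1/2 * a + 1/2 * b = (a + b) / 2" by (simp add: field_simps)
    have "2 * \<bar>1/2 * a + 1/2 * b\<bar> = \<bar>a + b\<bar>" unfolding half by simp
    then show ?thesis by (metis powr_mult)
  qed
  also have "\<dots> \<le> 2 powr p * (1/2 * \<bar>a\<bar> powr p + 1/2 * \<bar>b\<bar> powr p)"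
    using p by (intro mult_left_mono abs_powr_convex) auto
  also have "\<dots> \<le> 2 powr p * (\<bar>a\<bar> powr p + \<bar>b\<bar> powr p)"
    by (intro mult_left_mono add_mono) auto
  finally show ?thesis .
qed

lemma in_Lp_linear:
  assumes p: "p \<ge> 1" and f: "in_Lp p M f" and g: "in_Lp p M g"
  shows "in_Lp p M (\<lambda>x. c * f x + d * g x)"
proof -
  have [measurable]: "f \<in> borel_measurable M" "g \<in> borel_measurable M"
    using f g by (auto simp: in_Lp_def)
  have "integrable M (\<lambda>x. 2 powr p * (\<bar>c\<bar> powr p * \<bar>f x\<bar> powr p + \<bar>d\<bar> powr p * \<bar>g x\<bar> powr p))"
    using f g by (intro integrable_mult_right integrable_add) (auto simp: in_Lp_def)
  then have "integrable M (\<lambda>x. \<bar>c * f x + d * g x\<bar> powr p)"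
  proof (rule Bochner_Integration.integrable_bound)
    show "AE x in M. norm (\<bar>c * f x + d * g x\<bar> powr p)
        \<le> norm (2 powr p * (\<bar>c\<bar> powr p * \<bar>f x\<bar> powr p + \<bar>d\<bar> powr p * \<bar>g x\<bar> powr p))"
      using abs_powr_add_le[OF p] by (intro AE_I2) (simp flip: powr_mult abs_mult)
  qed measurable
  then show ?thesis by (simp add: in_Lp_def)
qed

lemma integral_abs_powr_tendsto_0:
  fixes f :: "nat \<Rightarrow> 'a \<Rightarrow> real"
  assumes p: "p \<ge> 1" and [measurable]: "\<And>n. f n \<in> borel_measurable M" "h \<in> borel_measurable M"
    and lim: "AE x in M. (\<lambda>n. f n x) \<longlonglongrightarrow> h x"
    and dom: "integrable M u" "\<And>n. AE x in M. \<bar>f n x - h x\<bar> powr p \<le> u x"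
  shows "(\<lambda>n. LINT x|M. \<bar>f n x - h x\<bar> powr p) \<longlonglongrightarrow> 0"
proof -
  have "(\<lambda>n. LINT x|M. \<bar>f n x - h x\<bar> powr p) \<longlonglongrightarrow> (LINT x|M. 0)"
  proof (rule integral_dominated_convergence[OF _ _ dom(1)])
    show "AE x in M. (\<lambda>n. \<bar>f n x - h x\<bar> powr p) \<longlonglongrightarrow> 0"
      using lim
    proof (rule eventually_mono)
      fix x assume "(\<lambda>n. f n x) \<longlonglongrightarrow> h x"
      then have "(\<lambda>n. \<bar>f n x - h x\<bar>) \<longlonglongrightarrow> 0"
        using tendsto_rabs_zero LIM_zero by blast
      then have "(\<lambda>n. \<bar>f n x - h x\<bar> powr p) \<longlonglongrightarrow> 0 powr p"
        using p by (intro tendsto_powr2) auto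
      then show "(\<lambda>n. \<bar>f n x - h x\<bar> powr p) \<longlonglongrightarrow> 0" by simp
    qed
    show "AE x in M. norm (\<bar>f n x - h x\<bar> powr p) \<le> u x" for n
      using dom(2)[of n] by simp
  qed measurable
  then show ?thesis by simp
qed

section \<open>Density of polynomials for the Jacobi weight\<close>

lemma borel_measurable_jacobi_measure [simp]:
  "borel_measurable (jacobi_measure \<alpha> \<beta>) = borel_measurable (lebesgue_on {-1..1})"
  unfolding jacobi_measure_def by (rule measurable_cong_sets[OF sets_density refl])

lemma borel_measurable_jacobi_weight:
  "(\<lambda>x::real. (1 - x) powr \<alpha> * (1 + x) powr \<beta>) \<in> borel_measurable (lebesgue_on {-1..1})"
  by (intro measurable_restrict_space1 measurable_completion) measurable

text \<open>
  The endpoints, at which the functions considered here need not have any derivative, form a null set.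
\<close>

lemma AE_jacobi_measureI:
  assumes N: "negligible N" and P: "\<And>x. x \<in> {-1<..<1} \<Longrightarrow> x \<notin> N \<Longrightarrow> P x"
  shows "AE x in jacobi_measure \<alpha> \<beta>. P x"
proof -
  have "N \<union> {-1,1} \<in> null_sets lebesgue"
    using N negligible_iff_null_sets[of "N \<union> {-1,1}"] by simp
  then have "AE x in lebesgue. x \<notin> N \<union> {-1,1}"
    by (rule AE_not_in)
  then have "AE x in lebesgue. x \<in> {-1..1} \<longrightarrow> P x"
  proof (rule eventually_mono)
    fix x :: real assume "x \<notin> N \<union> {-1,1}"
    then show "x \<in> {-1..1} \<longrightarrow> P x" using P[of x] by auto
  qed
  then have "AE x in lebesgue_on {-1..1}. P x"
    by (subst AE_restrict_space_iff) auto
  then show ?thesis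
    unfolding jacobi_measure_def using borel_measurable_jacobi_weight[of \<alpha> \<beta>]
    by (subst AE_density) (auto elim!: eventually_mono)
qed

text \<open>
  Lebesgue measurability is insensitive to null sets because the measure is complete. The proof reads
  this off the characterization by almost everywhere limits of continuous functions.
\<close>

lemma borel_measurable_lebesgue_on_spike:
  fixes f g :: "real \<Rightarrow> real"
  assumes S: "S \<in> sets lebesgue" and f: "f \<in> borel_measurable (lebesgue_on S)"
    and N: "negligible N" and eq: "\<And>x. x \<in> S \<Longrightarrow> x \<notin> N \<Longrightarrow> f x = g x"
  shows "g \<in> borel_measurable (lebesgue_on S)"
proof -
  have "f measurable_on S"
    using f S measurable_on_iff_borel_measurable by blast
  then obtain N' h where h: "negligible N'" "\<And>n. continuous_on UNIV (h n)"
    "\<And>x. x \<notin> N' \<Longrightarrow> (\<lambda>n. h n x) \<longlonglongrightarrow> (if x \<in> S then f x else 0)"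
    unfolding measurable_on_def by blast
  have "g measurable_on S"
    unfolding measurable_on_def
  proof (intro exI conjI allI impI)
    show "negligible (N \<union> N')" using N h by simp
    show "(\<lambda>n. h n x) \<longlonglongrightarrow> (if x \<in> S then g x else 0)" if "x \<notin> N \<union> N'" for x
      using h(3)[of x] that eq[of x] by auto
  qed (rule h)
  then show ?thesis
    using S measurable_on_iff_borel_measurable by blast
qed

text \<open>
  Up to the substitution \<open>x = 2 * t - 1\<close> the total mass is a Beta integral, which converges exactly
  for exponents above \<open>-1\<close>.
\<close>

lemma integrable_const_jacobi_measure:
  assumes ab: "\<alpha> > -1" "\<beta> > -1"
  shows "integrable (jacobi_measure \<alpha> \<beta>) (\<lambda>x. c::real)"
proof -
  let ?w = "\<lambda>x::real. (1 - x) powr \<alpha> * (1 + x) powr \<beta>"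
  have "(\<lambda>t. t powr (\<beta> + 1 - 1) * (1 - t) powr (\<alpha> + 1 - 1)) integrable_on cbox 0 (1::real)"
    using integrable_Beta'[of "\<beta> + 1" "\<alpha> + 1"] ab by simp
  note aff = integrable_affinity[OF this, of "1/2" "1/2"]
  have "(\<lambda>x. (x/2 + 1/2) powr \<beta> * (1/2 - x/2) powr \<alpha>) integrable_on {-1..1::real}"
  proof -
    have "(\<lambda>x::real. 2 * x - 1) ` {0..1} = {-1..1}"
      using image_affinity_atLeastAtMost[of 2 "-1" 0 1] by simp
    with aff show ?thesis by (simp add: algebra_simps)
  qed
  then have "(\<lambda>x. 2 powr (\<alpha> + \<beta>) * ((x/2 + 1/2) powr \<beta> * (1/2 - x/2) powr \<alpha>)) integrable_on {-1..1::real}"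
    by (rule integrable_on_mult_right)
  then have "?w integrable_on {-1..1}"
  proof (rule integrable_eq)
    fix x :: real assume x: "x \<in> {-1..1}"
    have "(x/2 + 1/2) powr \<beta> = (1 + x) powr \<beta> / 2 powr \<beta>"
      using x powr_divide[of "1 + x" 2 \<beta>] by (simp add: add_divide_distrib add.commute)
    moreover have "(1/2 - x/2) powr \<alpha> = (1 - x) powr \<alpha> / 2 powr \<alpha>"
      using x powr_divide[of "1 - x" 2 \<alpha>] by (simp add: diff_divide_distrib)
    ultimately show "2 powr (\<alpha> + \<beta>) * ((x/2 + 1/2) powr \<beta> * (1/2 - x/2) powr \<alpha>) = ?w x"
      by (simp add: powr_add)
  qed
  then have "?w absolutely_integrable_on {-1..1}"
    by (subst absolutely_integrable_on_iff_nonneg) auto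
  then have "integrable (lebesgue_on {-1..1}) ?w"
    by (simp add: set_integrable_def integrable_restrict_space)
  then have "integrable (lebesgue_on {-1..1}) (\<lambda>x. ?w x *\<^sub>R c)"
    by simp
  then show ?thesis
    unfolding jacobi_measure_def using borel_measurable_jacobi_weight[of \<alpha> \<beta>]
    by (subst integrable_density) auto
qed

lemma poly_approx_continuous:
  fixes g :: "real \<Rightarrow> real"
  assumes "continuous_on {a..b} g" "e > 0"
  shows "\<exists>P. \<forall>x\<in>{a..b}. \<bar>g x - poly P x\<bar> < e"
proof -
  obtain q where q: "real_polynomial_function q" "\<And>x. x \<in> {a..b} \<Longrightarrow> \<bar>g x - q x\<bar> < e"
    using Stone_Weierstrass_real_polynomial_function[OF compact_Icc assms] by blast
  then obtain c n where "q = (\<lambda>x. \<Sum>i\<le>n. c i * x ^ i)"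
    by (auto simp: real_polynomial_function_iff_sum)
  then have "q = poly (\<Sum>i\<le>n. monom (c i) i)"
    by (auto simp: poly_sum poly_monom)
  with q show ?thesis by blast
qed

text \<open>
  A measurable function is an almost everywhere limit of continuous ones. These may be clamped to the
  range of \<open>h\<close> and then replaced by uniformly close polynomials on the compact interval; the
  resulting polynomials are uniformly bounded, so dominated convergence applies to the finite measure.
\<close>

lemma polynomials_dense_bounded:
  fixes h :: "real \<Rightarrow> real"
  assumes p: "p \<ge> 1" and ab: "\<alpha> > -1" "\<beta> > -1"
    and h: "h \<in> borel_measurable (lebesgue_on {-1..1})" and N: "\<And>x. \<bar>h x\<bar> \<le> N"
  shows "\<exists>Q. (\<lambda>n. LINT x|jacobi_measure \<alpha> \<beta>. \<bar>poly (Q n) x - h x\<bar> powr p) \<longlonglongrightarrow> 0"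
proof -
  have N0: "N \<ge> 0" using N[of 0] by linarith
  have "h measurable_on {-1..1}"
    using h measurable_on_iff_borel_measurable[of "{-1..1}" h] by simp
  then obtain Z g where g: "negligible Z" "\<And>n. continuous_on UNIV (g n)"
    "\<And>x. x \<notin> Z \<Longrightarrow> (\<lambda>n. g n x) \<longlonglongrightarrow> (if x \<in> {-1..1} then h x else 0)"
    unfolding measurable_on_def by blast
  define k where "k = (\<lambda>n x. max (- N) (min N (g n x)))"
  have "\<exists>P. \<forall>x\<in>{-1..1}. \<bar>k n x - poly P x\<bar> < inverse (real (Suc n))" for n
    unfolding k_def
    by (intro poly_approx_continuous continuous_intros continuous_on_subset[OF g(2)]) auto
  then obtain Q where Q: "\<And>n x. x \<in> {-1..1} \<Longrightarrow> \<bar>k n x - poly (Q n) x\<bar> < inverse (real (Suc n))"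
    by metis
  have Qm: "(\<lambda>x. poly (Q n) x) \<in> borel_measurable (lebesgue_on {-1..1})" for n
    by (intro continuous_imp_measurable_on_sets_lebesgue continuous_intros) auto
  have "(\<lambda>n. LINT x|jacobi_measure \<alpha> \<beta>. \<bar>poly (Q n) x - h x\<bar> powr p) \<longlonglongrightarrow> 0"
  proof (rule integral_abs_powr_tendsto_0[OF p])
    show "integrable (jacobi_measure \<alpha> \<beta>) (\<lambda>x. (2 * N + 1) powr p)"
      by (rule integrable_const_jacobi_measure[OF ab])
    show "AE x in jacobi_measure \<alpha> \<beta>. \<bar>poly (Q n) x - h x\<bar> powr p \<le> (2 * N + 1) powr p" for n
    proof (rule AE_jacobi_measureI[of "{}"])
      fix x :: real assume "x \<in> {-1<..<1}"
      then have "\<bar>k n x - poly (Q n) x\<bar> < inverse (real (Suc n))" by (intro Q) auto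
      also have "\<dots> \<le> 1" by (simp add: field_simps)
      finally have "\<bar>k n x - poly (Q n) x\<bar> < 1" .
      moreover have "\<bar>k n x\<bar> \<le> N" using N0 by (auto simp: k_def)
      ultimately have "\<bar>poly (Q n) x - h x\<bar> \<le> 2 * N + 1" using N[of x] by linarith
      then show "\<bar>poly (Q n) x - h x\<bar> powr p \<le> (2 * N + 1) powr p"
        using p by (intro powr_mono2) auto
    qed simp
    show "AE x in jacobi_measure \<alpha> \<beta>. (\<lambda>n. poly (Q n) x) \<longlonglongrightarrow> h x"
    proof (rule AE_jacobi_measureI[OF g(1)])
      fix x :: real assume x: "x \<in> {-1<..<1}" "x \<notin> Z"
      have "(\<lambda>n. g n x) \<longlonglongrightarrow> h x" using g(3)[OF x(2)] x(1) by auto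
      then have "(\<lambda>n. k n x) \<longlonglongrightarrow> max (- N) (min N (h x))"
        unfolding k_def by (intro tendsto_intros)
      also have "max (- N) (min N (h x)) = h x" using N[of x] by linarith
      finally have 1: "(\<lambda>n. k n x) \<longlonglongrightarrow> h x" .
      have "(\<lambda>n. poly (Q n) x - k n x) \<longlonglongrightarrow> 0"
      proof (rule Lim_null_comparison[OF _ LIMSEQ_inverse_real_of_nat])
        have "norm (poly (Q n) x - k n x) \<le> inverse (real (Suc n))" for n
          using Q[of x n] x(1) by (simp add: abs_minus_commute less_imp_le)
        then show "\<forall>\<^sub>F n in sequentially. norm (poly (Q n) x - k n x) \<le> inverse (real (Suc n))"
          by simp
      qed
      from tendsto_add[OF this 1] show "(\<lambda>n. poly (Q n) x) \<longlonglongrightarrow> h x" by simp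
    qed
  qed (use h Qm in simp_all)
  then show ?thesis by blast
qed

text \<open>
  Truncating \<open>h\<close> at height \<open>n\<close> approximates it in the \<open>p\<close>-th mean, by dominated convergence with
  the majorant \<open>\<bar>h\<bar> powr p\<close>, and reduces the claim to bounded functions.
\<close>

proposition polynomials_dense_Lp_jacobi:
  assumes p: "p \<ge> 1" and ab: "\<alpha> > -1" "\<beta> > -1"
    and h: "in_Lp p (jacobi_measure \<alpha> \<beta>) h" and e: "e > 0"
  shows "\<exists>Q. (LINT x|jacobi_measure \<alpha> \<beta>. \<bar>poly Q x - h x\<bar> powr p) < e"
proof -
  let ?M = "jacobi_measure \<alpha> \<beta>"
  have hm: "h \<in> borel_measurable ?M" and hi: "integrable ?M (\<lambda>x. \<bar>h x\<bar> powr p)"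
    using h by (auto simp: in_Lp_def)
  note [measurable] = hm[simplified]
  define k where "k = (\<lambda>(n::nat) x. max (- real n) (min (real n) (h x)))"
  have km: "k n \<in> borel_measurable (lebesgue_on {-1..1})" for n
    unfolding k_def by measurable
  have k_bd: "\<bar>k n x\<bar> \<le> real n" for n x
    by (auto simp: k_def max_def min_def)
  have k_le: "\<bar>k n x - h x\<bar> \<le> \<bar>h x\<bar>" for n x
    by (auto simp: k_def max_def min_def)
  have kpow: "\<bar>k n x - h x\<bar> powr p \<le> \<bar>h x\<bar> powr p" for n x
    using p k_le by (intro powr_mono2) auto
  have "(\<lambda>n. LINT x|?M. \<bar>k n x - h x\<bar> powr p) \<longlonglongrightarrow> 0"
  proof (rule integral_abs_powr_tendsto_0[OF p _ _ _ hi])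
    show "AE x in ?M. (\<lambda>n. k n x) \<longlonglongrightarrow> h x"
    proof (rule AE_I2)
      fix x
      obtain m :: nat where m: "\<bar>h x\<bar> \<le> real m" using real_arch_simple by blast
      have "k n x = h x" if "n \<ge> m" for n
      proof -
        have "\<bar>h x\<bar> \<le> real n" using m that by linarith
        then show ?thesis by (auto simp: k_def max_def min_def)
      qed
      then show "(\<lambda>n. k n x) \<longlonglongrightarrow> h x"
        by (intro tendsto_eventually) (auto simp: eventually_sequentially)
    qed
  qed (use km kpow hm in auto)
  \<comment> \<open>Two errors, each enlarged by the factor \<open>2 powr p\<close>, have to add up to less than \<open>e\<close>.\<close>
  moreover have C: "e / (2 * 2 powr p) > 0" using e by simp
  ultimately obtain n where n: "(LINT x|?M. \<bar>k n x - h x\<bar> powr p) < e / (2 * 2 powr p)"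
    using order_tendstoD(2) eventually_happens' sequentially_bot by blast
  obtain Q where "(\<lambda>j. LINT x|?M. \<bar>poly (Q j) x - k n x\<bar> powr p) \<longlonglongrightarrow> 0"
    using polynomials_dense_bounded[OF p ab km k_bd] by blast
  then obtain j where j: "(LINT x|?M. \<bar>poly (Q j) x - k n x\<bar> powr p) < e / (2 * 2 powr p)"
    using order_tendstoD(2)[OF _ C] eventually_happens' sequentially_bot by blast
  define q where "q = poly (Q j)"
  have qm: "q \<in> borel_measurable (lebesgue_on {-1..1})"
    unfolding q_def by (intro continuous_imp_measurable_on_sets_lebesgue continuous_intros) auto
  have i1: "integrable ?M (\<lambda>x. \<bar>k n x - h x\<bar> powr p)"
    by (rule Bochner_Integration.integrable_bound[OF hi]) (use km kpow hm in auto)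
  have i2: "integrable ?M (\<lambda>x. \<bar>q x - k n x\<bar> powr p)"
  proof -
    have "bounded (q ` {-1..1})"
      unfolding q_def by (intro compact_imp_bounded compact_continuous_image continuous_intros) auto
    then obtain B where B: "\<And>x. x \<in> {-1..1} \<Longrightarrow> \<bar>q x\<bar> \<le> B"
      unfolding bounded_iff by (metis imageI real_norm_def)
    show ?thesis
    proof (rule Bochner_Integration.integrable_bound[OF integrable_const_jacobi_measure[OF ab]])
      show "AE x in ?M. norm (\<bar>q x - k n x\<bar> powr p) \<le> norm ((B + real n) powr p)"
      proof (rule AE_jacobi_measureI[of "{}"])
        fix x :: real assume "x \<in> {-1<..<1}"
        then have "\<bar>q x\<bar> \<le> B" by (intro B) auto
        then have "\<bar>q x - k n x\<bar> \<le> B + real n" using k_bd[of n x] by linarith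
        then show "norm (\<bar>q x - k n x\<bar> powr p) \<le> norm ((B + real n) powr p)"
          using p by (auto intro: powr_mono2)
      qed simp
    qed (use qm km in simp)
  qed
  have "(LINT x|?M. \<bar>q x - h x\<bar> powr p)
      \<le> (LINT x|?M. 2 powr p * (\<bar>q x - k n x\<bar> powr p + \<bar>k n x - h x\<bar> powr p))"
  proof (rule integral_mono_AE')
    show "integrable ?M (\<lambda>x. 2 powr p * (\<bar>q x - k n x\<bar> powr p + \<bar>k n x - h x\<bar> powr p))"
      using i1 i2 by simp
    show "AE x in ?M. \<bar>q x - h x\<bar> powr p \<le> 2 powr p * (\<bar>q x - k n x\<bar> powr p + \<bar>k n x - h x\<bar> powr p)"
      using abs_powr_add_le[OF p, of "q x - k n x" "k n x - h x" for x] by (intro AE_I2) simp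
  qed auto
  also have "\<dots> = 2 powr p * ((LINT x|?M. \<bar>q x - k n x\<bar> powr p) + (LINT x|?M. \<bar>k n x - h x\<bar> powr p))"
    using i1 i2 by simp
  also have "\<dots> < 2 powr p * (e / (2 * 2 powr p) + e / (2 * 2 powr p))"
    using n j by (intro mult_strict_left_mono add_strict_mono) (auto simp: q_def)
  also have "\<dots> = e" by (simp add: field_simps)
  finally show ?thesis unfolding q_def by blast
qed

lemma in_Lp_poly_jacobi:
  assumes p: "p \<ge> 1" and ab: "\<alpha> > -1" "\<beta> > -1"
  shows "in_Lp p (jacobi_measure \<alpha> \<beta>) (poly P)"
  unfolding in_Lp_def
proof
  show m: "poly P \<in> borel_measurable (jacobi_measure \<alpha> \<beta>)"
    unfolding borel_measurable_jacobi_measure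
    by (intro continuous_imp_measurable_on_sets_lebesgue continuous_intros) auto
  have "bounded (poly P ` {-1..1})"
    by (intro compact_imp_bounded compact_continuous_image continuous_intros) auto
  then obtain B where B: "\<And>x. x \<in> {-1..1} \<Longrightarrow> \<bar>poly P x\<bar> \<le> B"
    unfolding bounded_iff by (metis imageI real_norm_def)
  show "integrable (jacobi_measure \<alpha> \<beta>) (\<lambda>x. \<bar>poly P x\<bar> powr p)"
  proof (rule Bochner_Integration.integrable_bound[OF integrable_const_jacobi_measure[OF ab]])
    show "AE x in jacobi_measure \<alpha> \<beta>. norm (\<bar>poly P x\<bar> powr p) \<le> norm (B powr p)"
    proof (rule AE_jacobi_measureI[of "{}"])
      fix x :: real assume "x \<in> {-1<..<1}"
      then have "\<bar>poly P x\<bar> \<le> B" by (intro B) auto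
      then show "norm (\<bar>poly P x\<bar> powr p) \<le> norm (B powr p)"
        using p by (auto intro: powr_mono2)
    qed simp
  qed (use m in simp)
qed

section \<open>The space of functions and its seminorm\<close>

locale sobolev_setting =
  fixes p :: real and l :: nat and \<alpha> \<beta> :: real and w :: "nat \<Rightarrow> real"
  assumes p: "1 \<le> p" and l: "1 \<le> l" and ab: "\<alpha> > -1" "\<beta> > -1"
begin

abbreviation \<mu> :: "real measure" where "\<mu> \<equiv> jacobi_measure \<alpha> \<beta>"
abbreviation S :: "(real \<Rightarrow> real) set" where "S \<equiv> sob_functions p l \<alpha> \<beta> w"
abbreviation N :: "(real \<Rightarrow> real) \<Rightarrow> real" where "N \<equiv> sob_norm p l \<alpha> \<beta> w"

text \<open>
  The derivative of order \<open>l - 1\<close> is absolutely continuous on compact subintervals only, so the open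
  interval is exhausted by countably many of them.
\<close>

lemma negligible_no_nth_deriv:
  assumes f: "f \<in> S"
  shows "negligible {x \<in> {-1<..<1}. \<not> has_nth_deriv_at l f x}"
proof -
  obtain m where m: "l = Suc m" using l by (cases l) auto
  define g where "g = (deriv ^^ m) f"
  define a where "a = (\<lambda>n. 1 - inverse (real (Suc n)))"
  define B where "B = (\<lambda>n. {x \<in> {- a n<..<a n}. \<not> g field_differentiable (at x)})"
  have a1: "a n < 1" for n by (simp add: a_def)
  have "negligible (B n)" for n
  proof -
    have "compact {- a n..a n} \<and> {- a n..a n} \<subseteq> {-1<..<1}" using a1[of n] by auto
    then have "abs_continuous_on {- a n..a n} g"
      using f m by (auto simp: sob_functions_def g_def)
    then show ?thesis unfolding B_def by (rule abs_continuous_differentiable_ae)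
  qed
  then have "negligible (\<Union>n. B n)"
    by (intro negligible_countable_Union) auto
  moreover have "{x \<in> {-1<..<1}. \<not> has_nth_deriv_at l f x} \<subseteq> (\<Union>n. B n)"
  proof
    fix x assume x: "x \<in> {x \<in> {-1<..<1}. \<not> has_nth_deriv_at l f x}"
    then have "1 - \<bar>x\<bar> > 0" by auto
    then obtain n where "inverse (real (Suc n)) < 1 - \<bar>x\<bar>"
      using reals_Archimedean by blast
    then have xa: "x \<in> {- a n<..<a n}" by (auto simp: a_def)
    \<comment> \<open>All lower derivatives exist around \<open>x\<close>, so the last step is the only one that can fail.\<close>
    have "\<forall>\<^sub>F y in nhds x. y \<in> {-1<..<1}"
      using x by (intro eventually_nhds_in_open) auto
    then have "\<forall>\<^sub>F y in nhds x. has_nth_deriv_at m f y"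
    proof (rule eventually_mono)
      show "has_nth_deriv_at m f y" if "y \<in> {-1<..<1}" for y
        using f m that by (simp add: sob_functions_def)
    qed
    with x have "\<not> g field_differentiable (at x)"
      by (auto simp: m g_def)
    with xa show "x \<in> (\<Union>n. B n)" by (auto simp: B_def)
  qed
  ultimately show ?thesis using negligible_subset by blast
qed

lemma nth_deriv_linear_at_node:
  assumes "f \<in> S" "g \<in> S" "k < l"
  shows "(deriv ^^ k) (\<lambda>x. c * f x + d * g x) (w k) = c * (deriv ^^ k) f (w k) + d * (deriv ^^ k) g (w k)"
proof (cases "k = 0")
  case False
  then have "has_nth_deriv_at k f (w k)" "has_nth_deriv_at k g (w k)"
    using assms by (auto simp: sob_functions_def)
  then show ?thesis using nth_deriv_linear by blast
qed simp

lemma top_deriv_linear_ae: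
  assumes "f \<in> S" "g \<in> S"
  obtains Z where "negligible Z"
    "\<And>x. x \<in> {-1<..<1} \<Longrightarrow> x \<notin> Z \<Longrightarrow>
       (deriv ^^ l) (\<lambda>x. c * f x + d * g x) x = c * (deriv ^^ l) f x + d * (deriv ^^ l) g x"
proof
  let ?Z = "\<lambda>f. {x \<in> {-1<..<1}. \<not> has_nth_deriv_at l f x}"
  show "negligible (?Z f \<union> ?Z g)"
    using assms negligible_no_nth_deriv by (intro negligible_Un)
  fix x :: real assume "x \<in> {-1<..<1}" "x \<notin> ?Z f \<union> ?Z g"
  then have "has_nth_deriv_at l f x" "has_nth_deriv_at l g x" by auto
  then show "(deriv ^^ l) (\<lambda>x. c * f x + d * g x) x = c * (deriv ^^ l) f x + d * (deriv ^^ l) g x"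
    using nth_deriv_linear by blast
qed

lemma Lp_top_deriv: "f \<in> S \<Longrightarrow> in_Lp p \<mu> ((deriv ^^ l) f)"
  by (simp add: sob_functions_def)

lemma measurable_abs_powr_top_deriv:
  assumes "f \<in> S"
  shows "(\<lambda>x. \<bar>(deriv ^^ l) f x\<bar> powr p) \<in> borel_measurable \<mu>"
proof -
  have [measurable]: "(deriv ^^ l) f \<in> borel_measurable \<mu>"
    using Lp_top_deriv[OF assms] unfolding in_Lp_def by blast
  show ?thesis by measurable
qed

lemma in_Lp_spike:
  assumes f: "in_Lp p \<mu> f" and Z: "negligible Z"
    and eq: "\<And>x. x \<in> {-1<..<1} \<Longrightarrow> x \<notin> Z \<Longrightarrow> g x = f x"
  shows "in_Lp p \<mu> g"
proof -
  have fm: "f \<in> borel_measurable (lebesgue_on {-1..1})"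
    and fi: "integrable \<mu> (\<lambda>x. \<bar>f x\<bar> powr p)"
    using f by (auto simp: in_Lp_def)
  have gm: "g \<in> borel_measurable (lebesgue_on {-1..1})"
  proof (rule borel_measurable_lebesgue_on_spike[OF _ fm, of "Z \<union> {-1,1}"])
    show "negligible (Z \<union> {-1,1})" using Z by simp
    fix x :: real assume "x \<in> {-1..1}" "x \<notin> Z \<union> {-1,1}"
    then show "f x = g x" using eq[of x] by auto
  qed simp
  have "AE x in \<mu>. \<bar>f x\<bar> powr p = \<bar>g x\<bar> powr p"
    using eq by (intro AE_jacobi_measureI[OF Z]) simp
  then have "integrable \<mu> (\<lambda>x. \<bar>g x\<bar> powr p)"
    using fm gm fi integrable_cong_AE[of "\<lambda>x. \<bar>f x\<bar> powr p" \<mu> "\<lambda>x. \<bar>g x\<bar> powr p"] by auto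
  with gm show ?thesis by (simp add: in_Lp_def)
qed

text \<open>
  The point that needs care is membership in the \<open>L^p\<close> space: the top derivative of the combination is
  the combination of the top derivatives only almost everywhere.
\<close>

lemma sob_functions_linear:
  assumes f: "f \<in> S" and g: "g \<in> S"
  shows "(\<lambda>x. c * f x + d * g x) \<in> S"
proof -
  let ?h = "\<lambda>x. c * f x + d * g x"
  obtain m where m: "l = Suc m" using l by (cases l) auto
  have 1: "has_nth_deriv_at k ?h (w k)" if "k \<in> {1..<l}" for k
    using f g that nth_deriv_linear[of k f "w k" g c d] by (auto simp: sob_functions_def)
  have 2: "has_nth_deriv_at m ?h x \<and>
      (deriv ^^ m) ?h x = c * (deriv ^^ m) f x + d * (deriv ^^ m) g x" if "x \<in> {-1<..<1}" for x
    using f g that nth_deriv_linear[of m f x g c d] by (auto simp: sob_functions_def m)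
  have 3: "abs_continuous_on K ((deriv ^^ m) ?h)" if K: "compact K" "K \<subseteq> {-1<..<1}" for K
  proof -
    have "abs_continuous_on K (\<lambda>x. c * (deriv ^^ m) f x + d * (deriv ^^ m) g x)"
      using f g K by (intro abs_continuous_on_linear) (auto simp: sob_functions_def m)
    then show ?thesis
      by (rule abs_continuous_on_cong) (use 2 K(2) in auto)
  qed
  obtain Z where Z: "negligible Z" "\<And>x. x \<in> {-1<..<1} \<Longrightarrow> x \<notin> Z \<Longrightarrow>
       (deriv ^^ l) ?h x = c * (deriv ^^ l) f x + d * (deriv ^^ l) g x"
    using top_deriv_linear_ae[OF f g] by blast
  have 4: "in_Lp p \<mu> ((deriv ^^ l) ?h)"
    by (rule in_Lp_spike[OF in_Lp_linear[OF p Lp_top_deriv[OF f] Lp_top_deriv[OF g]] Z])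
  show ?thesis
    using 1 2 3 4 unfolding sob_functions_def m by auto
qed

lemma sob_functions_diff: "f \<in> S \<Longrightarrow> g \<in> S \<Longrightarrow> (\<lambda>x. f x - g x) \<in> S"
  using sob_functions_linear[of f g 1 "-1"] by simp

lemma sob_functions_add: "f \<in> S \<Longrightarrow> g \<in> S \<Longrightarrow> (\<lambda>x. f x + g x) \<in> S"
  using sob_functions_linear[of f g 1 1] by simp

lemma sob_functions_scale: "f \<in> S \<Longrightarrow> (\<lambda>x. c * f x) \<in> S"
  using sob_functions_linear[of f f c 0] by simp

lemma poly_in_sob_functions: "poly P \<in> S"
proof -
  have "abs_continuous_on K (poly Q)" if "compact K" for K Q
    using that by (intro abs_continuous_on_poly compact_imp_bounded)
  then show ?thesis
    unfolding sob_functions_def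
    by (auto simp: has_nth_deriv_at_poly nth_deriv_poly in_Lp_poly_jacobi p ab)
qed

text \<open>
  The \<open>p\<close>-th power of the seminorm. Unlike the seminorm it is additive over the nodes and the
  interval, so it inherits convexity from the scalar function \<open>\<lambda>y. \<bar>y\<bar> powr p\<close>.
\<close>

definition energy :: "(real \<Rightarrow> real) \<Rightarrow> real" where
  "energy f = (\<Sum>k<l. \<bar>(deriv ^^ k) f (w k)\<bar> powr p) + (LINT x|\<mu>. \<bar>(deriv ^^ l) f x\<bar> powr p)"

lemma energy_nonneg: "energy f \<ge> 0"
  unfolding energy_def by (intro add_nonneg_nonneg sum_nonneg integral_nonneg_AE) auto

lemma sob_norm_energy: "N f = energy f powr (1 / p)"
  by (simp add: sob_norm_def energy_def)

lemma energy_sob_norm: "energy f = N f powr p"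
  using p energy_nonneg[of f] by (simp add: sob_norm_energy powr_powr)

lemma sob_norm_nonneg: "N f \<ge> 0"
  by (simp add: sob_norm_def)

lemma energy_convex:
  assumes f: "f \<in> S" and g: "g \<in> S" and st: "s \<ge> 0" "t \<ge> 0" "s + t = 1"
  shows "energy (\<lambda>x. s * f x + t * g x) \<le> s * energy f + t * energy g"
proof -
  let ?h = "\<lambda>x. s * f x + t * g x"
  let ?F = "\<lambda>x. \<bar>(deriv ^^ l) f x\<bar> powr p" and ?G = "\<lambda>x. \<bar>(deriv ^^ l) g x\<bar> powr p"
  have i: "integrable \<mu> ?F" "integrable \<mu> ?G"
    using Lp_top_deriv[OF f] Lp_top_deriv[OF g] by (auto simp: in_Lp_def)
  have A: "(\<Sum>k<l. \<bar>(deriv ^^ k) ?h (w k)\<bar> powr p)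
      \<le> (\<Sum>k<l. s * \<bar>(deriv ^^ k) f (w k)\<bar> powr p + t * \<bar>(deriv ^^ k) g (w k)\<bar> powr p)"
    using abs_powr_convex[OF p st] by (intro sum_mono) (simp add: nth_deriv_linear_at_node[OF f g])
  obtain Z where Z: "negligible Z" "\<And>x. x \<in> {-1<..<1} \<Longrightarrow> x \<notin> Z \<Longrightarrow>
       (deriv ^^ l) ?h x = s * (deriv ^^ l) f x + t * (deriv ^^ l) g x"
    using top_deriv_linear_ae[OF f g] by blast
  have B: "(LINT x|\<mu>. \<bar>(deriv ^^ l) ?h x\<bar> powr p) \<le> (LINT x|\<mu>. s * ?F x + t * ?G x)"
  proof (rule integral_mono_AE')
    show "AE x in \<mu>. \<bar>(deriv ^^ l) ?h x\<bar> powr p \<le> s * ?F x + t * ?G x"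
      using Z(2) abs_powr_convex[OF p st] by (intro AE_jacobi_measureI[OF Z(1)]) simp
  qed (use i st in auto)
  have "(LINT x|\<mu>. s * ?F x + t * ?G x) = s * (LINT x|\<mu>. ?F x) + t * (LINT x|\<mu>. ?G x)"
    using i by simp
  moreover have "(\<Sum>k<l. s * \<bar>(deriv ^^ k) f (w k)\<bar> powr p + t * \<bar>(deriv ^^ k) g (w k)\<bar> powr p)
     = s * (\<Sum>k<l. \<bar>(deriv ^^ k) f (w k)\<bar> powr p) + t * (\<Sum>k<l. \<bar>(deriv ^^ k) g (w k)\<bar> powr p)"
    by (simp add: sum.distrib sum_distrib_left)
  ultimately show ?thesis
    using A B unfolding energy_def by (simp add: algebra_simps)
qed

lemma energy_scale:
  assumes f: "f \<in> S"
  shows "energy (\<lambda>x. c * f x) = \<bar>c\<bar> powr p * energy f"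
proof -
  have A: "\<bar>(deriv ^^ k) (\<lambda>x. c * f x) (w k)\<bar> powr p = \<bar>c\<bar> powr p * \<bar>(deriv ^^ k) f (w k)\<bar> powr p"
    if "k < l" for k
    using nth_deriv_linear_at_node[OF f f that, of c 0] by (simp add: abs_mult powr_mult)
  obtain Z where Z: "negligible Z" "\<And>x. x \<in> {-1<..<1} \<Longrightarrow> x \<notin> Z \<Longrightarrow>
       (deriv ^^ l) (\<lambda>x. c * f x + 0 * f x) x = c * (deriv ^^ l) f x + 0 * (deriv ^^ l) f x"
    using top_deriv_linear_ae[OF f f] by blast
  have cf: "(\<lambda>x. c * f x) \<in> S"
    using sob_functions_linear[OF f f, of c 0] by simp
  have "(LINT x|\<mu>. \<bar>(deriv ^^ l) (\<lambda>x. c * f x) x\<bar> powr p) = (LINT x|\<mu>. \<bar>c\<bar> powr p * \<bar>(deriv ^^ l) f x\<bar> powr p)"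
  proof (rule integral_cong_AE)
    show "AE x in \<mu>. \<bar>(deriv ^^ l) (\<lambda>x. c * f x) x\<bar> powr p = \<bar>c\<bar> powr p * \<bar>(deriv ^^ l) f x\<bar> powr p"
      using Z(2) by (intro AE_jacobi_measureI[OF Z(1)]) (simp add: abs_mult powr_mult)
  qed (intro borel_measurable_times borel_measurable_const measurable_abs_powr_top_deriv f cf)+
  then show ?thesis
    using A by (simp add: energy_def distrib_left sum_distrib_left)
qed

lemma sob_norm_scale:
  assumes "f \<in> S"
  shows "N (\<lambda>x. c * f x) = \<bar>c\<bar> * N f"
  using p energy_nonneg[of f]
  by (simp add: sob_norm_energy energy_scale[OF assms] powr_mult powr_powr)

lemma sob_norm_zero [simp]: "N (\<lambda>x. 0) = 0"
  using sob_norm_scale[OF poly_in_sob_functions, of 0 0] by simp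

text \<open>
  A positively homogeneous functional whose unit ball is convex is subadditive: \<open>f + g\<close> is
  \<open>A + B\<close> times a convex combination of \<open>f / A\<close> and \<open>g / B\<close>, both in the unit ball. The margin \<open>e\<close>
  makes \<open>A\<close> and \<open>B\<close> positive also when a seminorm vanishes.
\<close>

lemma sob_norm_triangle:
  assumes f: "f \<in> S" and g: "g \<in> S"
  shows "N (\<lambda>x. f x + g x) \<le> N f + N g"
proof (rule field_le_epsilon)
  fix e :: real assume "e > 0"
  define A where "A = N f + e / 2"
  define B where "B = N g + e / 2"
  have AB: "A > 0" "B > 0" using \<open>e > 0\<close> sob_norm_nonneg by (auto simp: A_def B_def add_nonneg_pos)
  have le1: "energy (\<lambda>x. inverse C * h x) \<le> 1" if "h \<in> S" "C > 0" "N h \<le> C" for h C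
  proof -
    have "energy (\<lambda>x. inverse C * h x) = (inverse C * N h) powr p"
      using that(2) sob_norm_nonneg[of h]
      by (simp add: energy_scale[OF that(1)] energy_sob_norm[of h] flip: powr_mult)
    also have "\<dots> \<le> 1 powr p"
      using that p sob_norm_nonneg[of h] by (intro powr_mono2) (auto simp: field_simps)
    finally show ?thesis by simp
  qed
  have S1: "(\<lambda>x. c * h x) \<in> S" if "h \<in> S" for c h
    using sob_functions_linear[OF that that, of c 0] by simp
  let ?u = "\<lambda>x. inverse A * f x" and ?v = "\<lambda>x. inverse B * g x"
  define s where "s = A / (A + B)"
  define t where "t = B / (A + B)"
  have st: "s \<ge> 0" "t \<ge> 0" "s + t = 1"
    using AB by (auto simp: s_def t_def simp flip: add_divide_distrib)
  have "energy (\<lambda>x. s * ?u x + t * ?v x) \<le> s * energy ?u + t * energy ?v"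
    by (rule energy_convex[OF S1[OF f] S1[OF g] st])
  also have "\<dots> \<le> s * 1 + t * 1"
    using AB f g st \<open>e > 0\<close> by (intro add_mono mult_left_mono le1) (auto simp: A_def B_def)
  finally have le: "energy (\<lambda>x. s * ?u x + t * ?v x) \<le> 1" using st by simp
  have "(A + B) * s * inverse A = 1" "(A + B) * t * inverse B = 1"
    using AB by (auto simp: s_def t_def)
  then have "(\<lambda>x. f x + g x) = (\<lambda>x. (A + B) * (s * ?u x + t * ?v x))"
    by (auto simp: distrib_left simp flip: mult.assoc)
  then have "N (\<lambda>x. f x + g x) = \<bar>A + B\<bar> * N (\<lambda>x. s * ?u x + t * ?v x)"
    using sob_norm_scale[OF sob_functions_linear[OF S1[OF f] S1[OF g]]] by simp
  also have "\<dots> \<le> (A + B) * 1"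
    using AB le energy_nonneg p by (intro mult_mono) (auto simp: sob_norm_energy powr_le1)
  finally show "N (\<lambda>x. f x + g x) \<le> N f + N g + e"
    by (simp add: A_def B_def)
qed

text \<open>
  A polynomial \<open>Q\<close> close to the top derivative in the \<open>p\<close>-th mean is integrated \<open>l\<close> times, with
  constants chosen such that the result interpolates the values and derivatives at the nodes. Then the
  discrete part of the seminorm of the difference vanishes and only the integral remains.
\<close>

proposition polynomials_dense_sobolev:
  assumes f: "f \<in> S"
  shows "\<exists>P. (\<lambda>n. N (\<lambda>x. poly (P n) x - f x)) \<longlonglongrightarrow> 0"
proof -
  have "\<exists>P. N (\<lambda>x. poly P x - f x) < e" if e: "e > 0" for e
  proof -
    obtain Q where Q: "(LINT x|\<mu>. \<bar>poly Q x - (deriv ^^ l) f x\<bar> powr p) < e powr p"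
      using polynomials_dense_Lp_jacobi[OF p ab Lp_top_deriv[OF f], of "e powr p"] e by auto
    obtain P where P: "(pderiv ^^ l) P = Q" "\<And>k. k < l \<Longrightarrow> poly ((pderiv ^^ k) P) (w k) = (deriv ^^ k) f (w k)"
      using poly_prescribed_derivatives[of l Q w "\<lambda>k. (deriv ^^ k) f (w k)"] by blast
    let ?h = "\<lambda>x. 1 * poly P x + (-1) * f x"
    have nodes: "(deriv ^^ k) ?h (w k) = 0" if "k < l" for k
      using P(2)[OF that]
      by (simp only: nth_deriv_linear_at_node[OF poly_in_sob_functions f that] nth_deriv_poly)
    have h: "?h \<in> S" by (rule sob_functions_linear[OF poly_in_sob_functions f])
    obtain Z where Z: "negligible Z" "\<And>x. x \<in> {-1<..<1} \<Longrightarrow> x \<notin> Z \<Longrightarrow>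
       (deriv ^^ l) ?h x = 1 * (deriv ^^ l) (poly P) x + (-1) * (deriv ^^ l) f x"
      using top_deriv_linear_ae[OF poly_in_sob_functions f] by blast
    have [measurable]: "poly Q \<in> borel_measurable \<mu>" "(deriv ^^ l) f \<in> borel_measurable \<mu>"
      using in_Lp_poly_jacobi[OF p ab] Lp_top_deriv[OF f] unfolding in_Lp_def by blast+
    have "(LINT x|\<mu>. \<bar>(deriv ^^ l) ?h x\<bar> powr p) = (LINT x|\<mu>. \<bar>poly Q x - (deriv ^^ l) f x\<bar> powr p)"
    proof (rule integral_cong_AE)
      show "AE x in \<mu>. \<bar>(deriv ^^ l) ?h x\<bar> powr p = \<bar>poly Q x - (deriv ^^ l) f x\<bar> powr p"
        using Z(2) by (intro AE_jacobi_measureI[OF Z(1)]) (simp add: nth_deriv_poly P(1))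
      show "(\<lambda>x. \<bar>poly Q x - (deriv ^^ l) f x\<bar> powr p) \<in> borel_measurable \<mu>" by measurable
    qed (rule measurable_abs_powr_top_deriv[OF h])
    then have "energy ?h < e powr p"
      using Q nodes p by (simp add: energy_def)
    then have "N ?h < (e powr p) powr (1 / p)"
      unfolding sob_norm_energy using p energy_nonneg by (intro powr_less_mono2) auto
    then have "N ?h < e" using e p by (simp add: powr_powr)
    then show ?thesis by auto
  qed
  then have "\<exists>P. N (\<lambda>x. poly P x - f x) < inverse (real (Suc n))" for n by simp
  then obtain P where P: "\<And>n. N (\<lambda>x. poly (P n) x - f x) < inverse (real (Suc n))" by metis
  have "(\<lambda>n. N (\<lambda>x. poly (P n) x - f x)) \<longlonglongrightarrow> 0"
  proof (rule Lim_null_comparison[OF _ LIMSEQ_inverse_real_of_nat])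
    show "\<forall>\<^sub>F n in sequentially. norm (N (\<lambda>x. poly (P n) x - f x)) \<le> inverse (real (Suc n))"
      using P sob_norm_nonneg by (simp add: less_imp_le)
  qed
  then show ?thesis by blast
qed

abbreviation sob_dist :: "(real \<Rightarrow> real) \<Rightarrow> (real \<Rightarrow> real) \<Rightarrow> real" where
  "sob_dist f g \<equiv> N (\<lambda>x. f x - g x)"

lemma sob_dist_commute:
  assumes "f \<in> S" "g \<in> S"
  shows "sob_dist f g = sob_dist g f"
  using sob_norm_scale[OF sob_functions_diff[OF assms], of "-1"] by simp

lemma sob_dist_triangle:
  assumes "f \<in> S" "g \<in> S" "h \<in> S"
  shows "sob_dist f h \<le> sob_dist f g + sob_dist g h"
  using sob_norm_triangle[OF sob_functions_diff[of f g] sob_functions_diff[of g h]] assms by simp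

lemma sob_dist_add:
  assumes "f \<in> S" "g \<in> S" "f' \<in> S" "g' \<in> S"
  shows "sob_dist (\<lambda>x. f x + g x) (\<lambda>x. f' x + g' x) \<le> sob_dist f f' + sob_dist g g'"
  using sob_norm_triangle[OF sob_functions_diff[of f f'] sob_functions_diff[of g g']] assms
  by (simp add: algebra_simps)

lemma sob_dist_scale:
  assumes "f \<in> S" "f' \<in> S"
  shows "sob_dist (\<lambda>x. c * f x) (\<lambda>x. c * f' x) = \<bar>c\<bar> * sob_dist f f'"
  using sob_norm_scale[OF sob_functions_diff[OF assms], of c] by (simp add: right_diff_distrib)

lemma sob_norm_diff_le:
  assumes "f \<in> S" "g \<in> S"
  shows "\<bar>N f - N g\<bar> \<le> sob_dist f g"
proof -
  have "N f \<le> sob_dist f g + N g"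
    using sob_norm_triangle[OF sob_functions_diff[OF assms] assms(2)] by simp
  moreover have "N g \<le> sob_dist g f + N f"
    using sob_norm_triangle[OF sob_functions_diff[OF assms(2,1)] assms(1)] by simp
  ultimately show ?thesis using sob_dist_commute[OF assms] by linarith
qed

lemma sob_dist_tendsto_0_trans:
  assumes "\<And>n. a n \<in> S" "\<And>n. b n \<in> S" "\<And>n. c n \<in> S"
    and "(\<lambda>n. sob_dist (a n) (b n)) \<longlonglongrightarrow> 0" "(\<lambda>n. sob_dist (b n) (c n)) \<longlonglongrightarrow> 0"
  shows "(\<lambda>n. sob_dist (a n) (c n)) \<longlonglongrightarrow> 0"
proof (rule Lim_null_comparison)
  show "\<forall>\<^sub>F n in sequentially. norm (sob_dist (a n) (c n)) \<le> sob_dist (a n) (b n) + sob_dist (b n) (c n)"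
    using sob_dist_triangle[OF assms(1-3)] sob_norm_nonneg by simp
  show "(\<lambda>n. sob_dist (a n) (b n) + sob_dist (b n) (c n)) \<longlonglongrightarrow> 0"
    using tendsto_add[OF assms(4,5)] by simp
qed

section \<open>The quotient space of functions\<close>

definition U_class :: "(real \<Rightarrow> real) \<Rightarrow> (real \<Rightarrow> real) set" where
  "U_class f = U_rel p l \<alpha> \<beta> w `` {f}"

abbreviation U :: "(real \<Rightarrow> real) set set" where
  "U \<equiv> U_space p l \<alpha> \<beta> w"

lemma equiv_U_rel: "equiv S (U_rel p l \<alpha> \<beta> w)"
proof (rule equivI)
  show "U_rel p l \<alpha> \<beta> w \<subseteq> S \<times> S" by (auto simp: U_rel_def)
  show "refl_on S (U_rel p l \<alpha> \<beta> w)"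
    by (rule refl_onI) (simp add: U_rel_def)
  show "sym (U_rel p l \<alpha> \<beta> w)"
  proof (rule symI)
    fix f g assume "(f, g) \<in> U_rel p l \<alpha> \<beta> w"
    then have "f \<in> S" "g \<in> S" "sob_dist f g = 0" by (auto simp: U_rel_def)
    with sob_dist_commute[of f g] show "(g, f) \<in> U_rel p l \<alpha> \<beta> w" by (simp add: U_rel_def)
  qed
  show "trans (U_rel p l \<alpha> \<beta> w)"
  proof (rule transI)
    fix f g h assume "(f, g) \<in> U_rel p l \<alpha> \<beta> w" "(g, h) \<in> U_rel p l \<alpha> \<beta> w"
    then have "f \<in> S" "g \<in> S" "h \<in> S" "sob_dist f g = 0" "sob_dist g h = 0"
      by (auto simp: U_rel_def)
    then show "(f, h) \<in> U_rel p l \<alpha> \<beta> w"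
      using sob_dist_triangle[of f g h] sob_norm_nonneg[of "\<lambda>x. f x - h x"]
      by (simp add: U_rel_def)
  qed
qed

lemma U_class_eq_iff: "f \<in> S \<Longrightarrow> g \<in> S \<Longrightarrow> U_class f = U_class g \<longleftrightarrow> sob_dist f g = 0"
  using eq_equiv_class_iff[OF equiv_U_rel] by (auto simp: U_class_def U_rel_def)

lemma in_U_class_iff: "f \<in> S \<Longrightarrow> g \<in> U_class f \<longleftrightarrow> g \<in> S \<and> sob_dist f g = 0"
  by (auto simp: U_class_def U_rel_def)

lemma U_spaceE:
  assumes "F \<in> U" obtains f where "f \<in> S" "F = U_class f"
  using assms unfolding U_space_def quotient_def U_class_def by blast

lemma U_class_in_U: "f \<in> S \<Longrightarrow> U_class f \<in> U"
  unfolding U_space_def U_class_def by (rule quotientI)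

lemma U_add_class:
  assumes "f \<in> S" "g \<in> S"
  shows "U_add p l \<alpha> \<beta> w (U_class f) (U_class g) = U_class (\<lambda>x. f x + g x)"
proof -
  have "U_class (\<lambda>x. f x + g x) = U_class (\<lambda>x. f' x + g' x)"
    if "f' \<in> U_class f" "g' \<in> U_class g" for f' g'
  proof -
    have *: "f' \<in> S" "g' \<in> S" "sob_dist f f' = 0" "sob_dist g g' = 0"
      using that assms by (auto simp: in_U_class_iff)
    then show ?thesis
      using sob_dist_add[of f g f' g'] assms sob_norm_nonneg
      by (subst U_class_eq_iff) (auto intro!: sob_functions_add antisym)
  qed
  moreover have "f \<in> U_class f" "g \<in> U_class g"
    using assms by (auto simp: in_U_class_iff)
  ultimately show ?thesis unfolding U_add_def U_class_def[symmetric] by blast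
qed

lemma U_scale_class:
  assumes "f \<in> S"
  shows "U_scale p l \<alpha> \<beta> w c (U_class f) = U_class (\<lambda>x. c * f x)"
proof -
  have "U_class (\<lambda>x. c * f x) = U_class (\<lambda>x. c * f' x)" if "f' \<in> U_class f" for f'
  proof -
    have *: "f' \<in> S" "sob_dist f f' = 0"
      using that assms by (auto simp: in_U_class_iff)
    then show ?thesis
      using sob_dist_scale[of f f' c] assms
      by (subst U_class_eq_iff) (auto intro!: sob_functions_scale)
  qed
  moreover have "f \<in> U_class f"
    using assms by (auto simp: in_U_class_iff)
  ultimately show ?thesis unfolding U_scale_def U_class_def[symmetric] by blast
qed

lemma U_norm_class:
  assumes "f \<in> S"
  shows "U_norm p l \<alpha> \<beta> w (U_class f) = N f"
proof -
  have "N f' = N f" if "f' \<in> U_class f" for f'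
    using that assms sob_norm_diff_le[of f f'] by (simp add: in_U_class_iff)
  moreover have "f \<in> U_class f"
    using assms by (auto simp: in_U_class_iff)
  ultimately have "N ` U_class f = {N f}" by blast
  then show ?thesis by (simp add: U_norm_def)
qed

lemma U_add_in_U: "F \<in> U \<Longrightarrow> G \<in> U \<Longrightarrow> U_add p l \<alpha> \<beta> w F G \<in> U"
  by (elim U_spaceE) (simp add: U_add_class U_class_in_U sob_functions_add)

lemma U_scale_in_U: "F \<in> U \<Longrightarrow> U_scale p l \<alpha> \<beta> w c F \<in> U"
  by (elim U_spaceE) (simp add: U_scale_class U_class_in_U sob_functions_scale)

section \<open>The completion of the polynomials\<close>

abbreviation CS :: "(nat \<Rightarrow> real poly) set" where
  "CS \<equiv> poly_Cauchy p l \<alpha> \<beta> w"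

abbreviation W_cl :: "(nat \<Rightarrow> real poly) \<Rightarrow> (nat \<Rightarrow> real poly) set" where
  "W_cl \<equiv> W_class p l \<alpha> \<beta> w"

abbreviation W :: "(nat \<Rightarrow> real poly) set set" where
  "W \<equiv> W_space p l \<alpha> \<beta> w"

lemma poly_diff_fun: "poly (P - Q) = (\<lambda>x. poly P x - poly Q x)" for P Q :: "real poly"
  by auto

lemma poly_add_fun: "poly (P + Q) = (\<lambda>x. poly P x + poly Q x)" for P Q :: "real poly"
  by auto

lemma poly_smult_fun: "poly (smult c P) = (\<lambda>x. c * poly P x)" for P :: "real poly"
  by auto

lemma poly_CauchyD:
  assumes "P \<in> CS" "e > 0"
  shows "\<exists>M. \<forall>m\<ge>M. \<forall>n\<ge>M. sob_dist (poly (P m)) (poly (P n)) < e"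
  using assms unfolding poly_Cauchy_def poly_diff_fun by blast

lemma poly_CauchyI:
  assumes "\<And>e. e > 0 \<Longrightarrow> \<exists>M. \<forall>m\<ge>M. \<forall>n\<ge>M. sob_dist (poly (P m)) (poly (P n)) < e"
  shows "P \<in> CS"
  using assms unfolding poly_Cauchy_def poly_diff_fun by blast

text \<open>
  This covers sums and scalar multiples of Cauchy sequences at once.
\<close>

lemma poly_Cauchy_if_controlled:
  assumes P: "P \<in> CS" and Q: "Q \<in> CS" and c: "c \<ge> 0"
    and R: "\<And>m n. sob_dist (poly (R m)) (poly (R n)) \<le>
      sob_dist (poly (P m)) (poly (P n)) + c * sob_dist (poly (Q m)) (poly (Q n))"
  shows "R \<in> CS"
proof (rule poly_CauchyI)
  fix e :: real assume e: "e > 0"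
  \<comment> \<open>Dividing by \<open>c + 1\<close> rather than by \<open>c\<close> allows \<open>c = 0\<close>.\<close>
  define d where "d = e / (2 * (c + 1))"
  have d: "d > 0" "c * d \<le> e / 2"
    using e c by (auto simp: d_def field_simps)
  obtain M1 where M1: "\<forall>m\<ge>M1. \<forall>n\<ge>M1. sob_dist (poly (P m)) (poly (P n)) < e / 2"
    using poly_CauchyD[OF P, of "e / 2"] e by auto
  obtain M2 where M2: "\<forall>m\<ge>M2. \<forall>n\<ge>M2. sob_dist (poly (Q m)) (poly (Q n)) < d"
    using poly_CauchyD[OF Q d(1)] by blast
  have "sob_dist (poly (R m)) (poly (R n)) < e" if "m \<ge> max M1 M2" "n \<ge> max M1 M2" for m n
  proof -
    have "sob_dist (poly (P m)) (poly (P n)) < e / 2" using M1 that by simp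
    moreover have "sob_dist (poly (Q m)) (poly (Q n)) \<le> d" using M2 that by (simp add: less_imp_le)
    then have "c * sob_dist (poly (Q m)) (poly (Q n)) \<le> c * d" using c by (rule mult_left_mono)
    ultimately show ?thesis using R[of m n] d(2) by linarith
  qed
  then show "\<exists>M. \<forall>m\<ge>M. \<forall>n\<ge>M. sob_dist (poly (R m)) (poly (R n)) < e" by blast
qed

lemma poly_Cauchy_zero: "(\<lambda>n. 0) \<in> CS"
  by (rule poly_CauchyI) (use sob_norm_zero in simp)

lemma poly_Cauchy_add:
  assumes "P \<in> CS" "Q \<in> CS" shows "(\<lambda>n. P n + Q n) \<in> CS"
  by (rule poly_Cauchy_if_controlled[OF assms, of 1])
     (use sob_dist_add[OF poly_in_sob_functions poly_in_sob_functions poly_in_sob_functions poly_in_sob_functions] in \<open>auto simp: poly_add_fun\<close>)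

lemma poly_Cauchy_smult:
  assumes "P \<in> CS" shows "(\<lambda>n. smult c (P n)) \<in> CS"
  by (rule poly_Cauchy_if_controlled[OF poly_Cauchy_zero assms, of "\<bar>c\<bar>"])
     (use sob_dist_scale[OF poly_in_sob_functions poly_in_sob_functions] sob_norm_nonneg in \<open>auto simp: poly_smult_fun\<close>)

lemma W_rel_iff:
  "(P, Q) \<in> W_rel p l \<alpha> \<beta> w \<longleftrightarrow>
     P \<in> CS \<and> Q \<in> CS \<and> (\<lambda>n. sob_dist (poly (P n)) (poly (Q n))) \<longlonglongrightarrow> 0"
  by (auto simp: W_rel_def poly_diff_fun)

lemma equiv_W_rel: "equiv CS (W_rel p l \<alpha> \<beta> w)"
proof (rule equivI)
  show "W_rel p l \<alpha> \<beta> w \<subseteq> CS \<times> CS" by (auto simp: W_rel_def)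
  show "refl_on CS (W_rel p l \<alpha> \<beta> w)"
    by (rule refl_onI) (simp add: W_rel_iff)
  show "sym (W_rel p l \<alpha> \<beta> w)"
  proof (rule symI)
    fix P Q assume "(P, Q) \<in> W_rel p l \<alpha> \<beta> w"
    moreover have "sob_dist (poly (Q n)) (poly (P n)) = sob_dist (poly (P n)) (poly (Q n))" for n
      by (rule sob_dist_commute[OF poly_in_sob_functions poly_in_sob_functions])
    ultimately show "(Q, P) \<in> W_rel p l \<alpha> \<beta> w" by (simp only: W_rel_iff)
  qed
  show "trans (W_rel p l \<alpha> \<beta> w)"
  proof (rule transI)
    fix P Q R assume "(P, Q) \<in> W_rel p l \<alpha> \<beta> w" "(Q, R) \<in> W_rel p l \<alpha> \<beta> w"
    then show "(P, R) \<in> W_rel p l \<alpha> \<beta> w"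
      unfolding W_rel_iff
      using sob_dist_tendsto_0_trans[of "\<lambda>n. poly (P n)" "\<lambda>n. poly (Q n)" "\<lambda>n. poly (R n)"] poly_in_sob_functions
      by blast
  qed
qed

lemma W_class_eq_iff:
  assumes "P \<in> CS" "Q \<in> CS"
  shows "W_cl P = W_cl Q \<longleftrightarrow> (\<lambda>n. sob_dist (poly (P n)) (poly (Q n))) \<longlonglongrightarrow> 0"
  using eq_equiv_class_iff[OF equiv_W_rel assms] assms by (simp add: W_class_def W_rel_iff)

lemma in_W_class_iff:
  "P \<in> CS \<Longrightarrow> Q \<in> W_cl P \<longleftrightarrow> Q \<in> CS \<and> W_cl Q = W_cl P"
  using W_class_eq_iff[of P Q] by (auto simp: W_class_def W_rel_iff)

lemma W_class_self: "P \<in> CS \<Longrightarrow> P \<in> W_cl P"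
  by (simp add: in_W_class_iff)

lemma W_spaceE:
  assumes "X \<in> W" obtains P where "P \<in> CS" "X = W_cl P"
  using assms unfolding W_space_def quotient_def W_class_def by blast

lemma W_class_in_W: "P \<in> CS \<Longrightarrow> W_cl P \<in> W"
  unfolding W_space_def W_class_def by (rule quotientI)

lemma W_add_class:
  assumes P: "P \<in> CS" and Q: "Q \<in> CS"
  shows "W_add p l \<alpha> \<beta> w (W_cl P) (W_cl Q) = W_cl (\<lambda>n. P n + Q n)"
proof -
  have "W_cl (\<lambda>n. P' n + Q' n) = W_cl (\<lambda>n. P n + Q n)" if "P' \<in> W_cl P" "Q' \<in> W_cl Q" for P' Q'
  proof -
    have C: "P' \<in> CS" "Q' \<in> CS" using that P Q by (auto simp: in_W_class_iff)
    have "(\<lambda>n. sob_dist (poly (P' n)) (poly (P n))) \<longlonglongrightarrow> 0"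
         "(\<lambda>n. sob_dist (poly (Q' n)) (poly (Q n))) \<longlonglongrightarrow> 0"
      using that P Q C by (auto simp: in_W_class_iff W_class_eq_iff)
    from tendsto_add[OF this]
    have "(\<lambda>n. sob_dist (poly (P' n)) (poly (P n)) + sob_dist (poly (Q' n)) (poly (Q n))) \<longlonglongrightarrow> 0"
      by simp
    then have "(\<lambda>n. sob_dist (poly (P' n + Q' n)) (poly (P n + Q n))) \<longlonglongrightarrow> 0"
    proof (rule Lim_null_comparison[rotated])
      show "\<forall>\<^sub>F n in sequentially. norm (sob_dist (poly (P' n + Q' n)) (poly (P n + Q n)))
          \<le> sob_dist (poly (P' n)) (poly (P n)) + sob_dist (poly (Q' n)) (poly (Q n))"
        using sob_dist_add[OF poly_in_sob_functions poly_in_sob_functions poly_in_sob_functions poly_in_sob_functions] sob_norm_nonneg by (simp add: poly_add_fun)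
    qed
    then show ?thesis
      by (subst W_class_eq_iff) (use C P Q poly_Cauchy_add in auto)
  qed
  then show ?thesis
    using W_class_self[OF P] W_class_self[OF Q] unfolding W_add_def by blast
qed

lemma W_scale_class:
  assumes P: "P \<in> CS"
  shows "W_scale p l \<alpha> \<beta> w c (W_cl P) = W_cl (\<lambda>n. smult c (P n))"
proof -
  have "W_cl (\<lambda>n. smult c (P' n)) = W_cl (\<lambda>n. smult c (P n))" if "P' \<in> W_cl P" for P'
  proof -
    have C: "P' \<in> CS" using that P by (auto simp: in_W_class_iff)
    have "(\<lambda>n. sob_dist (poly (P' n)) (poly (P n))) \<longlonglongrightarrow> 0"
      using that P C by (auto simp: in_W_class_iff W_class_eq_iff)
    from tendsto_mult_right_zero[OF this, of "\<bar>c\<bar>"]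
    have "(\<lambda>n. sob_dist (poly (smult c (P' n))) (poly (smult c (P n)))) \<longlonglongrightarrow> 0"
      by (simp only: poly_smult_fun sob_dist_scale[OF poly_in_sob_functions poly_in_sob_functions])
    then show ?thesis
      by (subst W_class_eq_iff) (use C P poly_Cauchy_smult in auto)
  qed
  then show ?thesis
    using W_class_self[OF P] unfolding W_scale_def by blast
qed

lemma poly_Cauchy_norm_convergent:
  assumes P: "P \<in> CS"
  shows "convergent (\<lambda>n. N (poly (P n)))"
proof -
  have "Cauchy (\<lambda>n. N (poly (P n)))"
  proof (rule CauchyI)
    fix e :: real assume "e > 0"
    then obtain M where M: "\<forall>m\<ge>M. \<forall>n\<ge>M. sob_dist (poly (P m)) (poly (P n)) < e"
      using poly_CauchyD[OF P] by blast
    have "norm (N (poly (P m)) - N (poly (P n))) < e" if "m \<ge> M" "n \<ge> M" for m n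
      using M that sob_norm_diff_le[OF poly_in_sob_functions poly_in_sob_functions, of "P m" "P n"] by fastforce
    then show "\<exists>M. \<forall>m\<ge>M. \<forall>n\<ge>M. norm (N (poly (P m)) - N (poly (P n))) < e" by blast
  qed
  then show ?thesis by (rule Cauchy_convergent)
qed

text \<open>
  The limit exists and depends on the class only because the seminorm is Lipschitz for the
  distance that it induces.
\<close>

lemma tendsto_W_norm_class:
  assumes P: "P \<in> CS"
  shows "(\<lambda>n. N (poly (P n))) \<longlonglongrightarrow> W_norm p l \<alpha> \<beta> w (W_cl P)"
proof -
  have lim: "(\<lambda>n. N (poly (P n))) \<longlonglongrightarrow> lim (\<lambda>n. N (poly (P n)))"
    using poly_Cauchy_norm_convergent[OF P] convergent_LIMSEQ_iff by blast
  have "lim (\<lambda>n. N (poly (Q n))) = lim (\<lambda>n. N (poly (P n)))" if "Q \<in> W_cl P" for Q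
  proof -
    have Q: "Q \<in> CS" and "(\<lambda>n. sob_dist (poly (Q n)) (poly (P n))) \<longlonglongrightarrow> 0"
      using that P by (auto simp: in_W_class_iff W_class_eq_iff)
    then have "(\<lambda>n. N (poly (Q n)) - N (poly (P n))) \<longlonglongrightarrow> 0"
      by (rule_tac Lim_null_comparison[rotated]) (auto simp: sob_norm_diff_le poly_in_sob_functions)
    from tendsto_add[OF this lim] have "(\<lambda>n. N (poly (Q n))) \<longlonglongrightarrow> lim (\<lambda>n. N (poly (P n)))"
      by simp
    then show ?thesis by (rule limI)
  qed
  then have "(\<lambda>Q. lim (\<lambda>n. N (poly (Q n)))) ` W_cl P = {lim (\<lambda>n. N (poly (P n)))}"
    using W_class_self[OF P] by blast
  with lim show ?thesis by (simp add: W_norm_def)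
qed

lemma W_norm_class_eqI:
  assumes "P \<in> CS" "(\<lambda>n. N (poly (P n))) \<longlonglongrightarrow> L"
  shows "W_norm p l \<alpha> \<beta> w (W_cl P) = L"
  using LIMSEQ_unique[OF tendsto_W_norm_class[OF assms(1)] assms(2)] .

text \<open>
  All identities and inequalities hold for classes of arbitrary Cauchy sequences, so only closure under the
  operations is left to check for \<open>V\<close>; negatives are multiples by \<open>-1\<close>.
\<close>

lemma normed_subspace_of_WI:
  assumes sub: "V \<subseteq> W" and zero: "W_zero p l \<alpha> \<beta> w \<in> V"
    and add: "\<And>X Y. X \<in> V \<Longrightarrow> Y \<in> V \<Longrightarrow> W_add p l \<alpha> \<beta> w X Y \<in> V"
    and scale: "\<And>c X. X \<in> V \<Longrightarrow> W_scale p l \<alpha> \<beta> w c X \<in> V"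
  shows "normed_subspace_of_W p l \<alpha> \<beta> w V"
proof -
  note cls = W_add_class W_scale_class poly_Cauchy_add poly_Cauchy_smult poly_Cauchy_zero
  let ?add = "W_add p l \<alpha> \<beta> w" and ?scl = "W_scale p l \<alpha> \<beta> w"
    and ?z = "W_zero p l \<alpha> \<beta> w" and ?nrm = "W_norm p l \<alpha> \<beta> w"
  have ex: "\<exists>P. P \<in> CS \<and> X = W_cl P" if "X \<in> V" for X
    using that sub W_spaceE by blast
  have z: "?z = W_cl (\<lambda>n. 0)" by (simp add: W_zero_def)
  have "?add (?add X Y) Z = ?add X (?add Y Z)" if "X \<in> V" "Y \<in> V" "Z \<in> V" for X Y Z
    using ex[OF that(1)] ex[OF that(2)] ex[OF that(3)] by (auto simp: cls add.assoc)
  moreover have "?add X Y = ?add Y X" if "X \<in> V" "Y \<in> V" for X Y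
    using ex[OF that(1)] ex[OF that(2)] by (auto simp: cls add.commute)
  moreover have "?add ?z X = X" if "X \<in> V" for X
    using ex[OF that] unfolding z by (auto simp: cls)
  moreover have "\<exists>Y\<in>V. ?add X Y = ?z" if X: "X \<in> V" for X
  proof
    obtain P where P: "P \<in> CS" "X = W_cl P" using ex[OF X] by blast
    have "?add X (?scl (-1) X) = W_cl (\<lambda>n. P n + smult (-1) (P n))"
      by (simp only: P W_scale_class W_add_class poly_Cauchy_smult)
    then show "?add X (?scl (-1) X) = ?z" by (simp add: z)
  qed (rule scale[OF X])
  moreover have "?scl c (?add X Y) = ?add (?scl c X) (?scl c Y)" if "X \<in> V" "Y \<in> V" for c X Y
    using ex[OF that(1)] ex[OF that(2)] by (auto simp: cls smult_add_right)
  moreover have "?scl (c + d) X = ?add (?scl c X) (?scl d X)" if "X \<in> V" for c d X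
    using ex[OF that] by (auto simp: cls smult_add_left)
  moreover have "?scl c (?scl d X) = ?scl (c * d) X" if "X \<in> V" for c d X
    using ex[OF that] by (auto simp: cls)
  moreover have "?scl 1 X = X" if "X \<in> V" for X
    using ex[OF that] by (auto simp: cls)
  moreover have "?nrm X \<ge> 0" if X: "X \<in> V" for X
  proof -
    obtain P where P: "P \<in> CS" "X = W_cl P" using ex[OF X] by blast
    show ?thesis unfolding P(2)
      by (rule LIMSEQ_le_const[OF tendsto_W_norm_class[OF P(1)]]) (use sob_norm_nonneg in blast)
  qed
  moreover have "?nrm X = 0 \<longleftrightarrow> X = ?z" if X: "X \<in> V" for X
  proof -
    obtain P where P: "P \<in> CS" "X = W_cl P" using ex[OF X] by blast
    have "X = ?z \<longleftrightarrow> (\<lambda>n. N (poly (P n))) \<longlonglongrightarrow> 0"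
      unfolding P(2) z by (subst W_class_eq_iff[OF P(1) poly_Cauchy_zero]) simp
    also have "\<dots> \<longleftrightarrow> ?nrm X = 0"
      unfolding P(2) using tendsto_W_norm_class[OF P(1)] LIMSEQ_unique by metis
    finally show ?thesis by blast
  qed
  moreover have "?nrm (?scl c X) = \<bar>c\<bar> * ?nrm X" if X: "X \<in> V" for c X
  proof -
    obtain P where P: "P \<in> CS" "X = W_cl P" using ex[OF X] by blast
    have "(\<lambda>n. N (poly (smult c (P n)))) \<longlonglongrightarrow> \<bar>c\<bar> * ?nrm X"
      unfolding poly_smult_fun sob_norm_scale[OF poly_in_sob_functions] P(2)
      by (intro tendsto_mult_left tendsto_W_norm_class P)
    then show ?thesis
      unfolding P(2) W_scale_class[OF P(1)] by (intro W_norm_class_eqI poly_Cauchy_smult P)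
  qed
  moreover have "?nrm (?add X Y) \<le> ?nrm X + ?nrm Y" if X: "X \<in> V" and Y: "Y \<in> V" for X Y
  proof -
    obtain P where P: "P \<in> CS" "X = W_cl P" using ex[OF X] by blast
    obtain Q where Q: "Q \<in> CS" "Y = W_cl Q" using ex[OF Y] by blast
    show ?thesis
      unfolding P(2) Q(2) W_add_class[OF P(1) Q(1)]
    proof (rule LIMSEQ_le[OF tendsto_W_norm_class[OF poly_Cauchy_add[OF P(1) Q(1)]]
                             tendsto_add[OF tendsto_W_norm_class[OF P(1)] tendsto_W_norm_class[OF Q(1)]]])
      show "\<exists>M. \<forall>n\<ge>M. N (poly (P n + Q n)) \<le> N (poly (P n)) + N (poly (Q n))"
        using sob_norm_triangle[OF poly_in_sob_functions poly_in_sob_functions] by (auto simp: poly_add_fun)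
    qed
  qed
  ultimately have "normed_space_on V ?add ?scl ?z ?nrm"
    using zero add scale unfolding normed_space_on_def by (intro conjI ballI allI) simp_all
  with sub show ?thesis by (simp add: normed_subspace_of_W_def)
qed

section \<open>Approximating sequences and the embedding\<close>

abbreviation approx :: "(nat \<Rightarrow> real poly) \<Rightarrow> (real \<Rightarrow> real) set \<Rightarrow> bool" where
  "approx \<equiv> approximates p l \<alpha> \<beta> w"

text \<open>
  Approximating one representative is enough, since representatives of a class have distance zero.
\<close>

lemma approximates_class_iff:
  assumes f: "f \<in> S"
  shows "approx P (U_class f) \<longleftrightarrow> (\<lambda>n. sob_dist (poly (P n)) f) \<longlonglongrightarrow> 0"
proof
  assume "approx P (U_class f)"
  moreover have "f \<in> U_class f" using f by (simp add: in_U_class_iff)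
  ultimately show "(\<lambda>n. sob_dist (poly (P n)) f) \<longlonglongrightarrow> 0" by (simp add: approximates_def)
next
  assume lim: "(\<lambda>n. sob_dist (poly (P n)) f) \<longlonglongrightarrow> 0"
  have "(\<lambda>n. sob_dist (poly (P n)) g) \<longlonglongrightarrow> 0" if "g \<in> U_class f" for g
    using that f lim by (intro sob_dist_tendsto_0_trans[of "\<lambda>n. poly (P n)" "\<lambda>n. f" "\<lambda>n. g"])
      (auto simp: in_U_class_iff poly_in_sob_functions)
  then show "approx P (U_class f)" by (simp add: approximates_def)
qed

lemma approximates_exists:
  assumes "F \<in> U" shows "\<exists>P. approx P F"
proof -
  obtain f where f: "f \<in> S" "F = U_class f" using assms by (rule U_spaceE)
  then show ?thesis
    using polynomials_dense_sobolev[OF f(1)] approximates_class_iff[OF f(1)] by blast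
qed

lemma approximates_Cauchy:
  assumes "F \<in> U" "approx P F"
  shows "P \<in> CS"
proof -
  obtain f where f: "f \<in> S" "F = U_class f" using assms(1) by (rule U_spaceE)
  have lim: "(\<lambda>n. sob_dist (poly (P n)) f) \<longlonglongrightarrow> 0"
    using assms(2) f approximates_class_iff by blast
  show ?thesis
  proof (rule poly_CauchyI)
    fix e :: real assume "e > 0"
    then have "\<forall>\<^sub>F n in sequentially. sob_dist (poly (P n)) f < e / 2"
      by (intro order_tendstoD(2)[OF lim]) simp
    then obtain M where M: "\<And>n. n \<ge> M \<Longrightarrow> sob_dist (poly (P n)) f < e / 2"
      by (auto simp: eventually_sequentially)
    have "sob_dist (poly (P m)) (poly (P n)) < e" if "m \<ge> M" "n \<ge> M" for m n
      using sob_dist_triangle[OF poly_in_sob_functions f(1) poly_in_sob_functions, of "P m" "P n"] sob_dist_commute[OF poly_in_sob_functions f(1), of "P n"]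
        M[OF that(1)] M[OF that(2)] by linarith
    then show "\<exists>M. \<forall>m\<ge>M. \<forall>n\<ge>M. sob_dist (poly (P m)) (poly (P n)) < e" by blast
  qed
qed

text \<open>
  Both sides say that the limits of the two sequences have distance zero. From left to right this is
  injectivity of the embedding, from right to left its independence of the approximating sequence.
\<close>

lemma approximates_class_eq_iff:
  assumes f: "f \<in> S" and g: "g \<in> S" and P: "approx P (U_class f)" and Q: "approx Q (U_class g)"
  shows "W_cl P = W_cl Q \<longleftrightarrow> U_class f = U_class g"
proof -
  have lims: "(\<lambda>n. sob_dist (poly (P n)) f) \<longlonglongrightarrow> 0" "(\<lambda>n. sob_dist f (poly (P n))) \<longlonglongrightarrow> 0"
      "(\<lambda>n. sob_dist (poly (Q n)) g) \<longlonglongrightarrow> 0" "(\<lambda>n. sob_dist g (poly (Q n))) \<longlonglongrightarrow> 0"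
    using P Q f g sob_dist_commute[OF poly_in_sob_functions] by (simp_all add: approximates_class_iff)
  have CS: "P \<in> CS" "Q \<in> CS"
    using approximates_Cauchy P Q f g U_class_in_U by blast+
  show ?thesis
  proof
    assume "W_cl P = W_cl Q"
    then have PQ: "(\<lambda>n. sob_dist (poly (P n)) (poly (Q n))) \<longlonglongrightarrow> 0"
      using W_class_eq_iff[OF CS] by blast
    have "(\<lambda>n. sob_dist f (poly (Q n))) \<longlonglongrightarrow> 0"
      using sob_dist_tendsto_0_trans[of "\<lambda>n. f" "\<lambda>n. poly (P n)" "\<lambda>n. poly (Q n)"]
        lims(2) PQ f poly_in_sob_functions by blast
    then have "(\<lambda>n::nat. sob_dist f g) \<longlonglongrightarrow> 0"
      using sob_dist_tendsto_0_trans[of "\<lambda>n. f" "\<lambda>n. poly (Q n)" "\<lambda>n. g"] lims(3) f g poly_in_sob_functions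
      by blast
    then have "sob_dist f g = 0" using LIMSEQ_const_iff by blast
    then show "U_class f = U_class g" using U_class_eq_iff[OF f g] by blast
  next
    assume "U_class f = U_class g"
    then have "(\<lambda>n. sob_dist (poly (P n)) g) \<longlonglongrightarrow> 0"
      using P approximates_class_iff[OF g] by simp
    then have "(\<lambda>n. sob_dist (poly (P n)) (poly (Q n))) \<longlonglongrightarrow> 0"
      using sob_dist_tendsto_0_trans[of "\<lambda>n. poly (P n)" "\<lambda>n. g" "\<lambda>n. poly (Q n)"]
        lims(4) g poly_in_sob_functions by blast
    then show "W_cl P = W_cl Q" using W_class_eq_iff[OF CS] by blast
  qed
qed

lemma approximates_unique:
  assumes "F \<in> U" "approx P F" "approx Q F"
  shows "W_cl P = W_cl Q"
  using assms approximates_class_eq_iff by (metis U_spaceE)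

lemma approximates_add:
  assumes "F \<in> U" "G \<in> U" "approx P F" "approx Q G"
  shows "approx (\<lambda>n. P n + Q n) (U_add p l \<alpha> \<beta> w F G)"
proof -
  obtain f where f: "f \<in> S" "F = U_class f" using assms(1) by (rule U_spaceE)
  obtain g where g: "g \<in> S" "G = U_class g" using assms(2) by (rule U_spaceE)
  have "(\<lambda>n. sob_dist (poly (P n)) f) \<longlonglongrightarrow> 0" "(\<lambda>n. sob_dist (poly (Q n)) g) \<longlonglongrightarrow> 0"
    using assms(3,4) f g approximates_class_iff by blast+
  from tendsto_add[OF this]
  have "(\<lambda>n. sob_dist (poly (P n)) f + sob_dist (poly (Q n)) g) \<longlonglongrightarrow> 0" by simp
  then have "(\<lambda>n. sob_dist (poly (P n + Q n)) (\<lambda>x. f x + g x)) \<longlonglongrightarrow> 0"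
  proof (rule Lim_null_comparison[rotated])
    show "\<forall>\<^sub>F n in sequentially. norm (sob_dist (poly (P n + Q n)) (\<lambda>x. f x + g x))
        \<le> sob_dist (poly (P n)) f + sob_dist (poly (Q n)) g"
      using sob_dist_add[OF poly_in_sob_functions poly_in_sob_functions f(1) g(1)] sob_norm_nonneg by (simp add: poly_add_fun)
  qed
  then show ?thesis
    unfolding f(2) g(2) U_add_class[OF f(1) g(1)]
    by (subst approximates_class_iff[OF sob_functions_add[OF f(1) g(1)]])
qed

lemma approximates_scale:
  assumes "F \<in> U" "approx P F"
  shows "approx (\<lambda>n. smult c (P n)) (U_scale p l \<alpha> \<beta> w c F)"
proof -
  obtain f where f: "f \<in> S" "F = U_class f" using assms(1) by (rule U_spaceE)
  have "(\<lambda>n. sob_dist (poly (P n)) f) \<longlonglongrightarrow> 0"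
    using assms(2) f approximates_class_iff by blast
  from tendsto_mult_right_zero[OF this, of "\<bar>c\<bar>"]
  have "(\<lambda>n. sob_dist (poly (smult c (P n))) (\<lambda>x. c * f x)) \<longlonglongrightarrow> 0"
    by (simp only: poly_smult_fun sob_dist_scale[OF poly_in_sob_functions f(1)])
  then show ?thesis
    unfolding f(2) U_scale_class[OF f(1)]
    by (subst approximates_class_iff[OF sob_functions_scale[OF f(1)]])
qed

lemma approximates_norm:
  assumes "F \<in> U" "approx P F"
  shows "W_norm p l \<alpha> \<beta> w (W_cl P) = U_norm p l \<alpha> \<beta> w F"
proof -
  obtain f where f: "f \<in> S" "F = U_class f" using assms(1) by (rule U_spaceE)
  have "(\<lambda>n. sob_dist (poly (P n)) f) \<longlonglongrightarrow> 0"
    using assms(2) f approximates_class_iff by blast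
  then have "(\<lambda>n. N (poly (P n)) - N f) \<longlonglongrightarrow> 0"
    by (rule Lim_null_comparison[rotated]) (simp add: sob_norm_diff_le poly_in_sob_functions f)
  then have "(\<lambda>n. N (poly (P n))) \<longlonglongrightarrow> N f" by (simp add: LIM_zero_iff)
  then show ?thesis
    using W_norm_class_eqI approximates_Cauchy[OF assms] U_norm_class[OF f(1)] f(2) by metis
qed

definition embed :: "(real \<Rightarrow> real) set \<Rightarrow> (nat \<Rightarrow> real poly) set" where
  "embed F = W_cl (SOME P. approx P F)"

lemma embed_eq:
  assumes "F \<in> U" "approx P F"
  shows "embed F = W_cl P"
  unfolding embed_def using assms by (metis approximates_unique someI)

lemma embed_add:
  assumes F: "F \<in> U" and G: "G \<in> U"
  shows "embed (U_add p l \<alpha> \<beta> w F G) = W_add p l \<alpha> \<beta> w (embed F) (embed G)"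
proof -
  obtain P where P: "approx P F" using approximates_exists[OF F] by blast
  obtain Q where Q: "approx Q G" using approximates_exists[OF G] by blast
  have "embed (U_add p l \<alpha> \<beta> w F G) = W_cl (\<lambda>n. P n + Q n)"
    by (rule embed_eq[OF U_add_in_U[OF F G] approximates_add[OF F G P Q]])
  then show ?thesis
    using W_add_class approximates_Cauchy[OF F P] approximates_Cauchy[OF G Q]
    by (simp add: embed_eq[OF F P] embed_eq[OF G Q])
qed

lemma embed_scale:
  assumes F: "F \<in> U"
  shows "embed (U_scale p l \<alpha> \<beta> w c F) = W_scale p l \<alpha> \<beta> w c (embed F)"
proof -
  obtain P where P: "approx P F" using approximates_exists[OF F] by blast
  have "embed (U_scale p l \<alpha> \<beta> w c F) = W_cl (\<lambda>n. smult c (P n))"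
    by (rule embed_eq[OF U_scale_in_U[OF F] approximates_scale[OF F P]])
  then show ?thesis
    using W_scale_class approximates_Cauchy[OF F P] by (simp add: embed_eq[OF F P])
qed

lemma embed_norm:
  assumes F: "F \<in> U"
  shows "W_norm p l \<alpha> \<beta> w (embed F) = U_norm p l \<alpha> \<beta> w F"
proof -
  obtain P where P: "approx P F" using approximates_exists[OF F] by blast
  show ?thesis by (simp add: embed_eq[OF F P] approximates_norm[OF F P])
qed

lemma inj_on_embed: "inj_on embed U"
proof (rule inj_onI)
  fix F G assume F: "F \<in> U" and G: "G \<in> U" and eq: "embed F = embed G"
  obtain P where P: "approx P F" using approximates_exists[OF F] by blast
  obtain Q where Q: "approx Q G" using approximates_exists[OF G] by blast
  obtain f where f: "f \<in> S" "F = U_class f" using F by (rule U_spaceE)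
  obtain g where g: "g \<in> S" "G = U_class g" using G by (rule U_spaceE)
  have "W_cl P = W_cl Q" using eq by (simp add: embed_eq[OF F P] embed_eq[OF G Q])
  then show "F = G"
    using approximates_class_eq_iff[OF f(1) g(1)] P Q f(2) g(2) by simp
qed

lemma normed_subspace_of_W_embed: "normed_subspace_of_W p l \<alpha> \<beta> w (embed ` U)"
proof (rule normed_subspace_of_WI)
  show "embed ` U \<subseteq> W"
    using approximates_exists approximates_Cauchy embed_eq W_class_in_W by (metis image_subsetI)
  have Z: "U_class (poly 0) \<in> U" using poly_in_sob_functions by (rule U_class_in_U)
  have "approx (\<lambda>n. 0) (U_class (poly 0))"
    using sob_norm_zero by (subst approximates_class_iff[OF poly_in_sob_functions]) simp
  then have "embed (U_class (poly 0)) = W_zero p l \<alpha> \<beta> w"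
    unfolding W_zero_def by (rule embed_eq[OF Z])
  with Z show "W_zero p l \<alpha> \<beta> w \<in> embed ` U" by (metis imageI)
  show "W_add p l \<alpha> \<beta> w X Y \<in> embed ` U" if "X \<in> embed ` U" "Y \<in> embed ` U" for X Y
    using that by (auto simp flip: embed_add intro!: imageI U_add_in_U)
  show "W_scale p l \<alpha> \<beta> w c X \<in> embed ` U" if "X \<in> embed ` U" for c X
    using that by (auto simp flip: embed_scale intro!: imageI U_scale_in_U)
qed

end

theorem proposition4p1:
  fixes p \<alpha> \<beta> :: real and l :: nat and w :: "nat \<Rightarrow> real"
  assumes "1 \<le> p" and "1 \<le> l" and "\<alpha> > -1" and "\<beta> > -1"
  shows "(\<forall>F \<in> U_space p l \<alpha> \<beta> w. \<exists>P :: nat \<Rightarrow> real poly. approximates p l \<alpha> \<beta> w P F) \<and>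
    (\<exists>\<iota>.
       (\<forall>F \<in> U_space p l \<alpha> \<beta> w. \<forall>P. approximates p l \<alpha> \<beta> w P F \<longrightarrow>
           P \<in> poly_Cauchy p l \<alpha> \<beta> w \<and> \<iota> F = W_class p l \<alpha> \<beta> w P) \<and>
       (\<forall>F \<in> U_space p l \<alpha> \<beta> w. \<forall>G \<in> U_space p l \<alpha> \<beta> w.
           \<iota> (U_add p l \<alpha> \<beta> w F G) = W_add p l \<alpha> \<beta> w (\<iota> F) (\<iota> G)) \<and>
       (\<forall>c. \<forall>F \<in> U_space p l \<alpha> \<beta> w.
           \<iota> (U_scale p l \<alpha> \<beta> w c F) = W_scale p l \<alpha> \<beta> w c (\<iota> F)) \<and>
       (\<forall>F \<in> U_space p l \<alpha> \<beta> w. W_norm p l \<alpha> \<beta> w (\<iota> F) = U_norm p l \<alpha> \<beta> w F) \<and>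
       inj_on \<iota> (U_space p l \<alpha> \<beta> w) \<and>
       normed_subspace_of_W p l \<alpha> \<beta> w (\<iota> ` U_space p l \<alpha> \<beta> w))"
proof -
  interpret sobolev_setting p l \<alpha> \<beta> w
    using assms by unfold_locales
  show ?thesis
  proof (intro conjI exI[of _ embed] ballI allI impI)
    fix F assume F: "F \<in> U"
    show "\<exists>P. approx P F" by (rule approximates_exists[OF F])
    show "W_norm p l \<alpha> \<beta> w (embed F) = U_norm p l \<alpha> \<beta> w F" by (rule embed_norm[OF F])
    show "embed (U_scale p l \<alpha> \<beta> w c F) = W_scale p l \<alpha> \<beta> w c (embed F)" for c
      by (rule embed_scale[OF F])
    show "embed (U_add p l \<alpha> \<beta> w F G) = W_add p l \<alpha> \<beta> w (embed F) (embed G)" if "G \<in> U" for G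
      by (rule embed_add[OF F that])
    fix P assume P: "approx P F"
    show "P \<in> CS" by (rule approximates_Cauchy[OF F P])
    show "embed F = W_cl P" by (rule embed_eq[OF F P])
  qed (rule inj_on_embed normed_subspace_of_W_embed)+
qed

end
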